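(* Let $1<p<\infty$, $z\in B_{\ell_p}$ and $s=(1-\|z\|^p)^{1/p}$. If $\varphi\in w^*\text{-}ac\{\delta_{\pi_n(z)+s e_{n+1}}: n\in\mathbb N\}$, then $$\mathcal{GP}(\varphi)\cap\overline{\{\delta_x: x\in B_{\ell_p}\}}^{w^*}=\{\varphi\}.$$ Consequently, if the corona is empty, $\mathcal{GP}(\varphi)$ reduces to the singleton $\{\varphi\}$.
   Context: $\ell_p$ is the complex sequence space with canonical vectors $(e_n)$; $B_{\ell_p}$ and $\overline B_{\ell_p}$ are its open and closed unit balls. $\mathcal A_u(B_{\ell_p})$ is the Banach algebra, with the supremum norm, of all uniformly continuous holomorphic functions $f:B_{\ell_p}\to\mathbb C$; each such $f$ extends continuously to $\overline B_{\ell_p}$. $\mathcal M(\mathcal A_u(B_{\ell_p}))$ is its spectrum: the set of all non-zero multiplicative linear functionals, with the $w^*$-topology inherited from $\mathcal A_u(B_{\ell_p})'$. For $x\in\overline B_{\ell_p}$, $\delta_x(f)=f(x)$. The Gleason part of $\varphi$ is $\mathcal{GP}(\varphi)=\{\psi\in\mathcal M(\mathcal A_u(B_{\ell_p})): \|\varphi-\psi\|<2\}$, where $\|\varphi-\psi\|=\sup\{|\varphi(f)-\psi(f)|:\|f\|\le1\}$. For a sequence $z=(z(i))_i$, $\pi_n(z)=(z(1),\dots,z(n),0,0,\dots)$. For a net (in particular a sequence) $(\varphi_\alpha)_{\alpha\in I}$ in the spectrum, $w^*\text{-}ac\{\varphi_\alpha:\alpha\in I\}$ is the set of all its $w^*$-accumulation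 (cluster) points. The corona is the set of all homomorphisms in $\mathcal M(\mathcal A_u(B_{\ell_p}))$ that are not $w^*$-limits of (nets of) evaluations $\delta_x$, $x\in B_{\ell_p}$, i.e. the complement of $\overline{\{\delta_x: x\in B_{\ell_p}\}}^{w^*}$. *)

theory Defs
  imports "HOL-Analysis.Analysis" "HOL-Library.Function_Algebras"
begin

section \<open>The complex sequence space $\ell_p$\<close>

text \<open>
  Since the real exponent \<open>p\<close> is a parameter, $\ell_p$ is a carrier set rather than a type.
  Sequences are indexed from 0, so the paper's $e_{n+1}$ is \<open>lp_unit n\<close>, while \<open>lp_proj n\<close>
  keeps the first \<open>n\<close> coordinates. Addition and multiplication of functions are pointwise.
\<close>

definition lp_space :: "real \<Rightarrow> (nat \<Rightarrow> complex) set" where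
  "lp_space p = {x. summable (\<lambda>i. norm (x i) powr p)}"

definition lp_norm :: "real \<Rightarrow> (nat \<Rightarrow> complex) \<Rightarrow> real" where
  "lp_norm p x = (\<Sum>i. norm (x i) powr p) powr (1 / p)"

definition lp_ball :: "real \<Rightarrow> (nat \<Rightarrow> complex) set" where
  "lp_ball p = {x \<in> lp_space p. lp_norm p x < 1}"

definition lp_unit :: "nat \<Rightarrow> nat \<Rightarrow> complex" where
  "lp_unit k = (\<lambda>i. if i = k then 1 else 0)"

definition lp_proj :: "nat \<Rightarrow> (nat \<Rightarrow> complex) \<Rightarrow> nat \<Rightarrow> complex" where
  "lp_proj n z = (\<lambda>i. if i < n then z i else 0)"


section \<open>The algebra of uniformly continuous holomorphic functions on the ball\<close>

definition lp_dual :: "real \<Rightarrow> ((nat \<Rightarrow> complex) \<Rightarrow> complex) set" where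
  "lp_dual p = {L.
     (\<forall>h\<in>lp_space p. \<forall>k\<in>lp_space p. L (h + k) = L h + L k) \<and>
     (\<forall>c. \<forall>h\<in>lp_space p. L (\<lambda>i. c * h i) = c * L h) \<and>
     (\<exists>C. \<forall>h\<in>lp_space p. norm (L h) \<le> C * lp_norm p h)}"

text \<open>Holomorphic means complex Frechet differentiable at every point of the open ball.\<close>

definition holomorphic_on_lp_ball :: "real \<Rightarrow> ((nat \<Rightarrow> complex) \<Rightarrow> complex) \<Rightarrow> bool" where
  "holomorphic_on_lp_ball p f \<longleftrightarrow>
     (\<forall>x\<in>lp_ball p. \<exists>L\<in>lp_dual p. \<forall>\<epsilon>>0. \<exists>\<delta>>0. \<forall>h\<in>lp_space p.
        lp_norm p h < \<delta> \<longrightarrow> x + h \<in> lp_ball p \<longrightarrow>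
        norm (f (x + h) - f x - L h) \<le> \<epsilon> * lp_norm p h)"

definition uniformly_continuous_on_lp_ball :: "real \<Rightarrow> ((nat \<Rightarrow> complex) \<Rightarrow> complex) \<Rightarrow> bool" where
  "uniformly_continuous_on_lp_ball p f \<longleftrightarrow>
     (\<forall>\<epsilon>>0. \<exists>\<delta>>0. \<forall>x\<in>lp_ball p. \<forall>y\<in>lp_ball p.
        lp_norm p (x - y) < \<delta> \<longrightarrow> norm (f x - f y) < \<epsilon>)"

text \<open>
  A function on the open ball is represented by its extension by 0 to all sequences. Thus
  equality in HOL is equality on the ball, and \<open>Au p\<close> is closed under pointwise operations.
\<close>

definition Au :: "real \<Rightarrow> ((nat \<Rightarrow> complex) \<Rightarrow> complex) set" where
  "Au p = {f. (\<forall>x. x \<notin> lp_ball p \<longrightarrow> f x = 0) \<and>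
              holomorphic_on_lp_ball p f \<and> uniformly_continuous_on_lp_ball p f}"

definition Au_norm :: "real \<Rightarrow> ((nat \<Rightarrow> complex) \<Rightarrow> complex) \<Rightarrow> real" where
  "Au_norm p f = (SUP x\<in>lp_ball p. norm (f x))"

text \<open>
  The continuous extension of a member of \<open>Au p\<close> to the closed ball: its value at \<open>x\<close> is
  the limit of \<open>f y\<close> as \<open>y\<close> tends to \<open>x\<close> in norm from within the open ball. On the
  open ball itself it agrees with \<open>f\<close>.
\<close>

definition lp_nhds_ball :: "real \<Rightarrow> (nat \<Rightarrow> complex) \<Rightarrow> (nat \<Rightarrow> complex) filter" where
  "lp_nhds_ball p x = (INF \<epsilon>\<in>{0<..}. principal {y \<in> lp_ball p. lp_norm p (y - x) < \<epsilon>})"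

definition Au_extension ::
  "real \<Rightarrow> ((nat \<Rightarrow> complex) \<Rightarrow> complex) \<Rightarrow> (nat \<Rightarrow> complex) \<Rightarrow> complex" where
  "Au_extension p f x = Lim (lp_nhds_ball p x) f"


section \<open>The spectrum\<close>

text \<open>
  Functionals are \<open>undefined\<close> off \<open>Au p\<close>, so that they are determined by their values there.
\<close>

definition Au_spectrum :: "real \<Rightarrow> (((nat \<Rightarrow> complex) \<Rightarrow> complex) \<Rightarrow> complex) set" where
  "Au_spectrum p = {\<phi> \<in> extensional (Au p).
     (\<forall>f\<in>Au p. \<forall>g\<in>Au p. \<phi> (f + g) = \<phi> f + \<phi> g) \<and>
     (\<forall>c. \<forall>f\<in>Au p. \<phi> (\<lambda>x. c * f x) = c * \<phi> f) \<and>
     (\<forall>f\<in>Au p. \<forall>g\<in>Au p. \<phi> (f * g) = \<phi> f * \<phi> g) \<and>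
     (\<exists>f\<in>Au p. \<phi> f \<noteq> 0)}"

text \<open>The weak-star topology is the topology of pointwise convergence on \<open>Au p\<close>.\<close>

definition spectrum_topology ::
  "real \<Rightarrow> (((nat \<Rightarrow> complex) \<Rightarrow> complex) \<Rightarrow> complex) topology" where
  "spectrum_topology p = subtopology (product_topology (\<lambda>_. euclidean) (Au p)) (Au_spectrum p)"

definition eval_hom :: "real \<Rightarrow> (nat \<Rightarrow> complex) \<Rightarrow> ((nat \<Rightarrow> complex) \<Rightarrow> complex) \<Rightarrow> complex" where
  "eval_hom p x = (\<lambda>f\<in>Au p. Au_extension p f x)"

text \<open>
  The supremum is over a bounded set, since multiplicative functionals on \<open>Au p\<close> are
  contractive.
\<close>

definition spectrum_dist :: "real \<Rightarrow> (((nat \<Rightarrow> complex) \<Rightarrow> complex) \<Rightarrow> complex) \<Rightarrow>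
    (((nat \<Rightarrow> complex) \<Rightarrow> complex) \<Rightarrow> complex) \<Rightarrow> real" where
  "spectrum_dist p \<phi> \<psi> = (SUP f\<in>{f \<in> Au p. Au_norm p f \<le> 1}. norm (\<phi> f - \<psi> f))"

definition gleason_part :: "real \<Rightarrow> (((nat \<Rightarrow> complex) \<Rightarrow> complex) \<Rightarrow> complex) \<Rightarrow>
    (((nat \<Rightarrow> complex) \<Rightarrow> complex) \<Rightarrow> complex) set" where
  "gleason_part p \<phi> = {\<psi> \<in> Au_spectrum p. spectrum_dist p \<phi> \<psi> < 2}"

definition ball_closure :: "real \<Rightarrow> (((nat \<Rightarrow> complex) \<Rightarrow> complex) \<Rightarrow> complex) set" where
  "ball_closure p = spectrum_topology p closure_of (eval_hom p ` lp_ball p)"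

definition corona :: "real \<Rightarrow> (((nat \<Rightarrow> complex) \<Rightarrow> complex) \<Rightarrow> complex) set" where
  "corona p = Au_spectrum p - ball_closure p"

text \<open>
  Cluster points of the sequence itself, not accumulation points of its range: every
  neighbourhood contains the terms with infinitely many indices.
\<close>

definition cluster_points :: "'a topology \<Rightarrow> (nat \<Rightarrow> 'a) \<Rightarrow> 'a set" where
  "cluster_points X \<sigma> =
     {a \<in> topspace X. \<forall>U. openin X U \<and> a \<in> U \<longrightarrow> (\<exists>\<^sub>F n in sequentially. \<sigma> n \<in> U)}"

end

theory Submission
  imports Defs
begin

text \<open>
  Write \<open>x k\<close> for \<open>lp_proj k z + s * lp_unit k\<close>. If \<open>\<psi>\<close> lies in the Gleason part of \<open>\<phi>\<close> and functions
  \<open>F m\<close> in the unit ball of the algebra satisfy \<open>\<phi> (F m) \<longlonglongrightarrow> 1\<close>, then \<open>\<psi> (F m) \<longlonglongrightarrow> 1\<close> (Schwarz-Pick). Given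
  \<open>g\<close> and \<open>e > 0\<close>, let \<open>A\<close> be the set of those \<open>k\<close> for which \<open>g (x k)\<close> is \<open>e\<close>-close to \<open>\<phi> g\<close>. The functions
  \<open>exp (n * (\<gamma> y - c) / s powr p) * (\<Sum>j\<in>A \<inter> {m..}. y j ^ n) / s ^ n\<close>, where \<open>\<gamma>\<close> is the functional norming
  the first \<open>m\<close> coordinates of \<open>z\<close>, are bounded by 1, nearly attain 1 at every \<open>x k\<close> with \<open>k \<in> A \<inter> {m..}\<close>,
  and for large \<open>m\<close> the exponents \<open>n\<close> and \<open>n + 1\<close> together are close to 1 only near such points. The
  exponential factor is tuned so that Young's inequality for \<open>\<gamma>\<close> and \<open>b * exp (1 - b) \<le> 1\<close> balance. If \<open>\<psi>\<close> is
  also a limit of evaluations, these take place near points \<open>x k\<close> with \<open>k \<in> A\<close>, so \<open>\<psi> g\<close> is close to \<open>\<phi> g\<close>.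
\<close>

section \<open>Norm estimates in the sequence space\<close>

text \<open>The evaluations at the points \<open>x k\<close> may have many cluster points, and a
  function peaking at all \<open>x k\<close> alike could not tell \<phi> from the others; this is
  why the peak is tied to \<open>g\<close> and \<open>e\<close> through \<open>A\<close>. It has to
  be near 1 at infinitely many points that spend the mass \<open>s powr p\<close> in different
  coordinates, and a plain sum of coordinates over an infinite \<open>A\<close> is unbounded on the
  ball for p > 1. Powers with n > p cure this: their sum is at most the tail mass times the (n/p -
  1)-th power of the largest \<open>norm (y j) powr p\<close>, so it stays bounded and rewards a
  tail concentrated in one coordinate. The two factors compete for the same mass: enlarging the
  power sum takes mass from the head of y and lowers the exponential. The ratio \<open>b\<close> of
  the tail mass to \<open>s powr p\<close> measures this exchange, with its optimum at 1. Only
  \<open>m\<close> coordinates of z are tested, at a price governed by the tail mass of z, so sharp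
  statements appear only as m tends to infinity.\<close>

lemma lp_norm_nonneg: "0 \<le> lp_norm p x"
  by (simp add: lp_norm_def)

lemma lp_suminf_nonneg: "x \<in> lp_space p \<Longrightarrow> 0 \<le> (\<Sum>i. norm (x i) powr p)"
  by (simp add: lp_space_def suminf_nonneg)

lemma lp_norm_powr: "0 < p \<Longrightarrow> x \<in> lp_space p \<Longrightarrow> lp_norm p x powr p = (\<Sum>i. norm (x i) powr p)"
  by (simp add: lp_norm_def powr_powr lp_suminf_nonneg)

lemma lp_norm_less_iff:
  assumes "0 < p" "x \<in> lp_space p" "0 < c"
  shows "lp_norm p x < c \<longleftrightarrow> (\<Sum>i. norm (x i) powr p) < c powr p"
  using assms lp_norm_powr[OF assms(1,2)] lp_norm_nonneg[of p x]
  by (metis less_eq_real_def not_le powr_less_mono2 powr_mono2)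

lemma lp_norm_le_iff:
  assumes "0 < p" "x \<in> lp_space p" "0 \<le> c"
  shows "lp_norm p x \<le> c \<longleftrightarrow> (\<Sum>i. norm (x i) powr p) \<le> c powr p"
  using assms lp_norm_powr[OF assms(1,2)] lp_norm_nonneg[of p x]
  by (metis less_eq_real_def not_le powr_less_mono2 powr_mono2)

lemma mem_lp_ball_iff:
  "0 < p \<Longrightarrow> x \<in> lp_ball p \<longleftrightarrow> x \<in> lp_space p \<and> (\<Sum>i. norm (x i) powr p) < 1"
  using lp_norm_less_iff[of p x 1] by (auto simp: lp_ball_def)

lemma lp_ball_subset: "x \<in> lp_ball p \<Longrightarrow> x \<in> lp_space p"
  by (simp add: lp_ball_def)

text \<open>A sum is at most twice its larger summand. The resulting constant
  \<open>2 powr p\<close> is crude, but it acts on each coordinate separately and so can be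
  summed.\<close>

lemma norm_add_powr_le:
  fixes a b :: "'a::real_normed_vector"
  assumes "0 < p"
  shows "norm (a + b) powr p \<le> 2 powr p * (norm a powr p + norm b powr p)"
proof -
  have "norm (a + b) \<le> 2 * max (norm a) (norm b)"
    using norm_triangle_ineq[of a b] by linarith
  then have "norm (a + b) powr p \<le> (2 * max (norm a) (norm b)) powr p"
    using assms by (intro powr_mono2) auto
  also have "\<dots> = 2 powr p * max (norm a) (norm b) powr p"
    by (simp add: powr_mult)
  also have "\<dots> \<le> 2 powr p * (norm a powr p + norm b powr p)"
    by (intro mult_left_mono) (auto simp: max_def)
  finally show ?thesis .
qed

lemma lp_space_add:
  assumes "0 < p" "x \<in> lp_space p" "y \<in> lp_space p"
  shows "x + y \<in> lp_space p"
proof -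
  have "summable (\<lambda>i. 2 powr p * (norm (x i) powr p + norm (y i) powr p))"
    using assms by (intro summable_mult summable_add) (auto simp: lp_space_def)
  then show ?thesis
    unfolding lp_space_def mem_Collect_eq
    by (rule summable_comparison_test') (use norm_add_powr_le[OF assms(1)] in auto)
qed

lemma lp_space_scale:
  assumes "x \<in> lp_space p" shows "(\<lambda>i. c * x i) \<in> lp_space p"
  using assms by (auto simp: lp_space_def norm_mult powr_mult intro: summable_mult)

lemma lp_norm_scale:
  assumes "0 < p" "x \<in> lp_space p"
  shows "lp_norm p (\<lambda>i. c * x i) = norm c * lp_norm p x"
proof -
  have "(\<Sum>i. norm (c * x i) powr p) = norm c powr p * (\<Sum>i. norm (x i) powr p)"
    using assms by (simp add: lp_space_def norm_mult powr_mult suminf_mult)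
  then show ?thesis
    using assms by (simp add: lp_norm_def powr_mult powr_powr lp_suminf_nonneg)
qed

lemma lp_space_diff:
  assumes "0 < p" "x \<in> lp_space p" "y \<in> lp_space p"
  shows "x - y \<in> lp_space p"
proof -
  have "x - y = x + (\<lambda>i. - 1 * y i)" by auto
  then show ?thesis
    using lp_space_add[OF assms(1,2) lp_space_scale[OF assms(3)]] by (simp only:)
qed

lemma lp_norm_minus_commute: "lp_norm p (x - y) = lp_norm p (y - x)"
  by (simp add: lp_norm_def norm_minus_commute)

text \<open>A quasi-triangle inequality: the factor 4 absorbs \<open>2 powr p * 2\<close> because 2
  is at most \<open>2 powr p\<close> for p at least 1. It serves epsilon-delta arguments, where any
  fixed factor will do.\<close>

lemma lp_norm_add_less:
  assumes "1 \<le> p" "x \<in> lp_space p" "y \<in> lp_space p" "lp_norm p x < c" "lp_norm p y < c"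
  shows "lp_norm p (x + y) < 4 * c"
proof -
  have p: "0 < p" and c: "0 < c" using assms lp_norm_nonneg[of p x] by auto
  have s: "summable (\<lambda>i. norm (x i) powr p)" "summable (\<lambda>i. norm (y i) powr p)"
    using assms by (auto simp: lp_space_def)
  have "(\<Sum>i. norm ((x + y) i) powr p) \<le> (\<Sum>i. 2 powr p * (norm (x i) powr p + norm (y i) powr p))"
    using lp_space_add[OF p assms(2,3)] norm_add_powr_le[OF p]
    by (intro suminf_le summable_mult summable_add s) (auto simp: lp_space_def)
  also have "\<dots> = 2 powr p * ((\<Sum>i. norm (x i) powr p) + (\<Sum>i. norm (y i) powr p))"
    by (simp add: suminf_mult suminf_add s summable_add)
  also have "\<dots> < 2 powr p * (c powr p + c powr p)"
    using assms lp_norm_less_iff[OF p] c by (intro mult_strict_left_mono add_strict_mono) auto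
  also have "\<dots> = (2 powr p * 2) * c powr p" by simp
  also have "\<dots> \<le> (2 powr p * 2 powr p) * c powr p"
    using powr_mono[of 1 p 2] assms by (intro mult_right_mono mult_left_mono) auto
  also have "\<dots> = (4 * c) powr p"
    using c powr_mult[of 2 2 p] powr_mult[of 4 c p] by simp
  finally show ?thesis
    using lp_norm_less_iff[OF p lp_space_add[OF p assms(2,3)], of "4 * c"] c by simp
qed

lemma lp_norm_diff_less:
  assumes "1 \<le> p" "x \<in> lp_space p" "y \<in> lp_space p" "w \<in> lp_space p"
    "lp_norm p (x - w) < c" "lp_norm p (y - w) < c"
  shows "lp_norm p (x - y) < 4 * c"
proof -
  have "x - y = (x - w) + (w - y)" by auto
  then show ?thesis
    using assms lp_norm_add_less[of p "x - w" "w - y" c] lp_space_diff[of p] lp_norm_minus_commute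
    by auto
qed

lemma norm_coord_le_lp_norm:
  assumes "0 < p" "x \<in> lp_space p"
  shows "norm (x i) \<le> lp_norm p x"
proof -
  have "norm (x i) powr p \<le> (\<Sum>i. norm (x i) powr p)"
    using assms sum_le_suminf[of "\<lambda>i. norm (x i) powr p" "{i}"] by (auto simp: lp_space_def)
  also have "\<dots> = lp_norm p x powr p" using lp_norm_powr assms by simp
  finally show ?thesis
    using assms(1) lp_norm_nonneg by (metis norm_ge_zero not_le powr_less_mono2)
qed

lemma zero_in_lp_ball: "(\<lambda>_. 0) \<in> lp_ball p"
  by (auto simp: lp_space_def lp_ball_def lp_norm_def)

lemma lp_ball_scale:
  assumes "0 < p" "x \<in> lp_space p" "lp_norm p x \<le> 1" "0 \<le> r" "r < 1"
  shows "(\<lambda>i. of_real r * x i) \<in> lp_ball p"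
proof -
  have "r * lp_norm p x \<le> r * 1" using assms by (intro mult_left_mono) auto
  then show ?thesis
    using assms by (auto simp: lp_ball_def lp_norm_scale intro: lp_space_scale)
qed

lemma lp_norm_scale_diff:
  assumes "0 < p" "x \<in> lp_space p"
  shows "lp_norm p ((\<lambda>i. of_real r * x i) - (\<lambda>i. of_real r' * x i)) = \<bar>r - r'\<bar> * lp_norm p x"
proof -
  have "(\<lambda>i. of_real r * x i) - (\<lambda>i. of_real r' * x i) = (\<lambda>i. of_real (r - r') * x i)"
    by (auto simp: algebra_simps)
  then show ?thesis using lp_norm_scale[OF assms, of "of_real (r - r')"] by (simp del: of_real_diff)
qed

section \<open>The algebra\<close>

lemma AuI:
  assumes "\<And>x. x \<notin> lp_ball p \<Longrightarrow> f x = 0"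
    and "holomorphic_on_lp_ball p f" "uniformly_continuous_on_lp_ball p f"
  shows "f \<in> Au p"
  using assms by (simp add: Au_def)

lemma Au_zero_outside: "f \<in> Au p \<Longrightarrow> x \<notin> lp_ball p \<Longrightarrow> f x = 0"
  by (simp add: Au_def)

lemma lp_dualE:
  assumes "L \<in> lp_dual p"
  obtains C where "0 \<le> C" "\<And>h. h \<in> lp_space p \<Longrightarrow> norm (L h) \<le> C * lp_norm p h"
proof -
  obtain C where C: "\<forall>h\<in>lp_space p. norm (L h) \<le> C * lp_norm p h"
    using assms by (auto simp: lp_dual_def)
  have "norm (L h) \<le> \<bar>C\<bar> * lp_norm p h" if "h \<in> lp_space p" for h
    using bspec[OF C that] mult_right_mono[OF abs_ge_self lp_norm_nonneg, of C p h] by linarith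
  then show thesis using that[of "\<bar>C\<bar>"] by auto
qed

lemma lp_dual_scale:
  assumes "L \<in> lp_dual p" shows "(\<lambda>h. c * L h) \<in> lp_dual p"
proof -
  obtain C where C: "0 \<le> C" "\<And>h. h \<in> lp_space p \<Longrightarrow> norm (L h) \<le> C * lp_norm p h"
    using lp_dualE[OF assms] by blast
  have "norm (c * L h) \<le> (norm c * C) * lp_norm p h" if "h \<in> lp_space p" for h
    using mult_left_mono[OF C(2)[OF that] norm_ge_zero[of c]] by (simp add: norm_mult mult_ac)
  then have "\<exists>C. \<forall>h\<in>lp_space p. norm (c * L h) \<le> C * lp_norm p h" by blast
  then show ?thesis using assms
    by (simp add: lp_dual_def algebra_simps)
qed

lemma lp_dual_add:
  assumes "L \<in> lp_dual p" "M \<in> lp_dual p" shows "(\<lambda>h. L h + M h) \<in> lp_dual p"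
proof -
  obtain C D where C: "\<And>h. h \<in> lp_space p \<Longrightarrow> norm (L h) \<le> C * lp_norm p h"
    "\<And>h. h \<in> lp_space p \<Longrightarrow> norm (M h) \<le> D * lp_norm p h"
    using lp_dualE[OF assms(1)] lp_dualE[OF assms(2)] by metis
  have "norm (L h + M h) \<le> (C + D) * lp_norm p h" if "h \<in> lp_space p" for h
    using norm_triangle_ineq[of "L h" "M h"] C[OF that] by (simp add: distrib_right)
  then have "\<exists>C. \<forall>h\<in>lp_space p. norm (L h + M h) \<le> C * lp_norm p h" by blast
  then show ?thesis using assms
    by (simp add: lp_dual_def algebra_simps)
qed

text \<open>Each x is reached from 0 in \<open>k\<close> equal steps along its ray; a step is
  shorter than \<open>d\<close> and changes f by less than 1. Here \<open>k\<close> depends on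
  \<open>d\<close> alone. Outside the ball f is 0, so the bound holds everywhere.\<close>

lemma Au_bounded:
  assumes "1 \<le> p" "f \<in> Au p"
  obtains M where "\<And>x. norm (f x) \<le> M"
proof -
  obtain d where d: "0 < d"
    "\<And>x y. x \<in> lp_ball p \<Longrightarrow> y \<in> lp_ball p \<Longrightarrow> lp_norm p (x - y) < d \<Longrightarrow> norm (f x - f y) < 1"
    using assms(2) zero_less_one unfolding Au_def uniformly_continuous_on_lp_ball_def by blast
  obtain k where k: "0 < k" "1 / real k < d"
    using d(1) reals_Archimedean[of d] by (metis inverse_eq_divide zero_less_Suc)
  have p: "0 < p" using assms by simp
  have bd: "norm (f x) \<le> norm (f (\<lambda>_. 0)) + real k" if x: "x \<in> lp_ball p" for x
  proof -
    define y where "y i = (\<lambda>l. of_real (real i / real k) * x l)" for i :: nat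
    have x1: "x \<in> lp_space p" "lp_norm p x < 1" using x by (auto simp: lp_ball_def)
    have yb: "y i \<in> lp_ball p" if "i \<le> k" for i
    proof (cases "i = k")
      case True
      then show ?thesis using k x by (simp add: y_def)
    next
      case False
      then show ?thesis unfolding y_def
        using that k x1 by (intro lp_ball_scale[OF p]) auto
    qed
    have "norm (f (y i)) \<le> norm (f (\<lambda>_. 0)) + real i" if "i \<le> k" for i
      using that
    proof (induction i)
      case 0
      then show ?case by (simp add: y_def)
    next
      case (Suc i)
      have eq: "real (Suc i) / real k - real i / real k = 1 / real k"
        unfolding diff_divide_distrib[symmetric] by simp
      have "lp_norm p (y (Suc i) - y i) = (1 / real k) * lp_norm p x"
        unfolding y_def lp_norm_scale_diff[OF p x1(1)] eq by simp
      also have "\<dots> \<le> (1 / real k) * 1" using x1 k by (intro mult_left_mono) auto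
      finally have "norm (f (y (Suc i)) - f (y i)) < 1"
        using Suc.prems k by (intro d(2) yb) auto
      then show ?case
        using Suc norm_triangle_sub[of "f (y (Suc i))" "f (y i)"] by simp
    qed
    from this[of k] show ?thesis using k by (simp add: y_def)
  qed
  have "norm (f x) \<le> norm (f (\<lambda>_. 0)) + real k" for x
    using bd[of x] Au_zero_outside[OF assms(2), of x] by (cases "x \<in> lp_ball p") auto
  then show thesis using that by blast
qed

text \<open>The chain rule supplies the derivative \<open>D * L h\<close>, and the compact set of
  values inside the domain turns continuity of F into uniform continuity. Affine images, powers,
  exponentials and inverses in the algebra all come from here.\<close>

lemma Au_compose:
  assumes f: "f \<in> Au p" and F: "F holomorphic_on S" "open S"
    and K: "compact K" "K \<subseteq> S" "\<And>x. x \<in> lp_ball p \<Longrightarrow> f x \<in> K"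
  shows "(\<lambda>x. if x \<in> lp_ball p then F (f x) else 0) \<in> Au p"
proof (rule AuI)
  show "holomorphic_on_lp_ball p (\<lambda>x. if x \<in> lp_ball p then F (f x) else 0)"
    unfolding holomorphic_on_lp_ball_def
  proof
    fix x assume x: "x \<in> lp_ball p"
    obtain L where L: "L \<in> lp_dual p" and Ld: "\<And>\<epsilon>. \<epsilon> > 0 \<Longrightarrow> \<exists>\<delta>>0. \<forall>h\<in>lp_space p.
        lp_norm p h < \<delta> \<longrightarrow> x + h \<in> lp_ball p \<longrightarrow> norm (f (x + h) - f x - L h) \<le> \<epsilon> * lp_norm p h"
      using f x unfolding Au_def holomorphic_on_lp_ball_def by blast
    obtain C where C: "0 \<le> C" "\<And>h. h \<in> lp_space p \<Longrightarrow> norm (L h) \<le> C * lp_norm p h"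
      using lp_dualE[OF L] by blast
    define D where "D = deriv F (f x)"
    have "(F has_field_derivative D) (at (f x))"
      using holomorphic_derivI[OF F, of "f x"] K x unfolding D_def by blast
    then have hd: "(F has_derivative (*) D) (at (f x))"
      by (simp add: has_field_derivative_def)
    show "\<exists>L\<in>lp_dual p. \<forall>\<epsilon>>0. \<exists>\<delta>>0. \<forall>h\<in>lp_space p. lp_norm p h < \<delta> \<longrightarrow> x + h \<in> lp_ball p \<longrightarrow>
        norm ((if x + h \<in> lp_ball p then F (f (x + h)) else 0) -
          (if x \<in> lp_ball p then F (f x) else 0) - L h) \<le> \<epsilon> * lp_norm p h"
    proof (intro bexI[OF _ lp_dual_scale[OF L, of D]] allI impI)
      fix e :: real assume e: "e > 0"
      \<comment> \<open>The error splits into that of F at the increment of f and \<open>D\<close>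
        times that of f; each gets half of \<open>e\<close>. The cap 1 on \<open>e2\<close> bounds
        the increment of f by \<open>C + 1\<close> times the norm of h, which the denominators of
        \<open>e1\<close> and \<open>d\<close> compensate.\<close>
      define e1 where "e1 = e / (2 * (C + 1))"
      define e2 where "e2 = min 1 (e / (2 * (norm D + 1)))"
      have ep: "e1 > 0" "e2 > 0" "e2 \<le> 1"
        using e C(1) by (auto simp: e1_def e2_def divide_pos_pos add_nonneg_pos)
      obtain d1 where d1: "d1 > 0"
        "\<And>w. norm (w - f x) < d1 \<Longrightarrow> norm (F w - F (f x) - D * (w - f x)) \<le> e1 * norm (w - f x)"
        using hd ep unfolding has_derivative_at_alt by metis
      obtain d2 where d2: "d2 > 0" "\<And>h. h \<in> lp_space p \<Longrightarrow> lp_norm p h < d2 \<Longrightarrow> x + h \<in> lp_ball p \<Longrightarrow>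
          norm (f (x + h) - f x - L h) \<le> e2 * lp_norm p h"
        using Ld[OF ep(2)] by blast
      define d where "d = min d2 (d1 / (C + 1))"
      have "d > 0" using d1 d2 C by (auto simp: d_def add_nonneg_pos)
      moreover have "norm (F (f (x + h)) - F (f x) - D * L h) \<le> e * lp_norm p h"
        if h: "h \<in> lp_space p" "lp_norm p h < d" "x + h \<in> lp_ball p" for h
      proof -
        let ?n = "lp_norm p h" and ?k = "f (x + h) - f x"
        have n0: "0 \<le> ?n" by (rule lp_norm_nonneg)
        have r: "norm (?k - L h) \<le> e2 * ?n" using d2(2) h by (simp add: d_def)
        also have "\<dots> \<le> 1 * ?n" using ep n0 by (intro mult_right_mono)
        finally have k: "norm ?k \<le> (C + 1) * ?n"
          using C(2)[OF h(1)] norm_triangle_sub[of ?k "L h"] by (simp add: algebra_simps)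
        also have "\<dots> < d1" using h(2) C(1) by (simp add: d_def field_simps)
        finally have "norm (F (f (x + h)) - F (f x) - D * ?k) \<le> e1 * norm ?k" by (rule d1(2))
        also have "\<dots> \<le> e1 * ((C + 1) * ?n)" using k ep by (intro mult_left_mono) auto
        also have "\<dots> = e / 2 * ?n"
          using C(1) unfolding e1_def by (simp add: divide_simps) (simp add: algebra_simps)?
        finally have 1: "norm (F (f (x + h)) - F (f x) - D * ?k) \<le> e / 2 * ?n" .
        have "norm (D * (?k - L h)) \<le> (norm D + 1) * (e2 * ?n)"
          unfolding norm_mult using r by (intro mult_mono) auto
        also have "\<dots> \<le> (norm D + 1) * (e / (2 * (norm D + 1)) * ?n)"
          using n0 by (intro mult_left_mono mult_right_mono) (auto simp: e2_def)
        also have "\<dots> = e / 2 * ?n"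
          using add_nonneg_pos[OF norm_ge_zero[of D] zero_less_one] by (simp add: divide_simps) (simp add: algebra_simps)?
        finally have 2: "norm (D * (?k - L h)) \<le> e / 2 * ?n" .
        have eq: "F (f (x + h)) - F (f x) - D * L h =
            (F (f (x + h)) - F (f x) - D * ?k) + D * (?k - L h)" by (simp add: algebra_simps)
        show ?thesis
          unfolding eq using norm_triangle_le[OF add_mono[OF 1 2]] by (simp flip: distrib_right)
      qed
      ultimately show "\<exists>\<delta>>0. \<forall>h\<in>lp_space p. lp_norm p h < \<delta> \<longrightarrow> x + h \<in> lp_ball p \<longrightarrow>
          norm ((if x + h \<in> lp_ball p then F (f (x + h)) else 0) -
            (if x \<in> lp_ball p then F (f x) else 0) - D * L h) \<le> e * lp_norm p h"
        using x by (intro exI[of _ d]) auto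
    qed
  qed
  show "uniformly_continuous_on_lp_ball p (\<lambda>x. if x \<in> lp_ball p then F (f x) else 0)"
    unfolding uniformly_continuous_on_lp_ball_def
  proof (intro allI impI)
    fix e :: real assume e: "e > 0"
    have "uniformly_continuous_on K F"
      using F K by (meson compact_uniformly_continuous continuous_on_subset holomorphic_on_imp_continuous_on)
    then obtain d where d: "d > 0" "\<And>v w. v \<in> K \<Longrightarrow> w \<in> K \<Longrightarrow> dist v w < d \<Longrightarrow> dist (F v) (F w) < e"
      using e unfolding uniformly_continuous_on_def by metis
    obtain d' where d': "d' > 0" "\<And>x y. x \<in> lp_ball p \<Longrightarrow> y \<in> lp_ball p \<Longrightarrow> lp_norm p (x - y) < d' \<Longrightarrow> norm (f x - f y) < d"
      using f d(1) unfolding Au_def uniformly_continuous_on_lp_ball_def by blast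
    show "\<exists>\<delta>>0. \<forall>x\<in>lp_ball p. \<forall>y\<in>lp_ball p. lp_norm p (x - y) < \<delta> \<longrightarrow>
        norm ((if x \<in> lp_ball p then F (f x) else 0) - (if y \<in> lp_ball p then F (f y) else 0)) < e"
      using d d' K(3) by (intro exI[of _ d']) (auto simp: dist_norm)
  qed
qed auto

lemma Au_zero: "(\<lambda>x. 0) \<in> Au p"
proof (rule AuI)
  have "(\<lambda>h. 0) \<in> lp_dual p" by (auto simp: lp_dual_def intro!: exI[of _ 0])
  then show "holomorphic_on_lp_ball p (\<lambda>x. 0)"
    unfolding holomorphic_on_lp_ball_def using lp_norm_nonneg
    by (auto intro!: bexI[of _ "\<lambda>h. 0"] exI[of _ 1])
  show "uniformly_continuous_on_lp_ball p (\<lambda>x. 0)"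
    unfolding uniformly_continuous_on_lp_ball_def by (auto intro: exI[of _ 1])
qed auto

lemma Au_const: "(\<lambda>x. if x \<in> lp_ball p then c else 0) \<in> Au p"
  using Au_compose[OF Au_zero, of "\<lambda>_. c" UNIV "{0}"] by auto

lemma Au_compose_entire:
  assumes "1 \<le> p" "f \<in> Au p" "F holomorphic_on UNIV"
  shows "(\<lambda>x. if x \<in> lp_ball p then F (f x) else 0) \<in> Au p"
proof -
  obtain M where "\<And>x. norm (f x) \<le> M" using Au_bounded[OF assms(1,2)] by blast
  then show ?thesis by (intro Au_compose[OF assms(2,3), of "cball 0 M"]) auto
qed

lemma Au_scale:
  assumes "1 \<le> p" "f \<in> Au p" shows "(\<lambda>x. c * f x) \<in> Au p"
proof -
  have eq: "(\<lambda>x. c * f x) = (\<lambda>x. if x \<in> lp_ball p then c * f x else 0)"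
    using Au_zero_outside[OF assms(2)] by (intro ext) (metis mult_zero_right)
  show ?thesis
    unfolding eq by (rule Au_compose_entire[OF assms, where F = "\<lambda>w. c * w"]) (intro holomorphic_intros)
qed

lemma Au_add:
  assumes f: "f \<in> Au p" and g: "g \<in> Au p" shows "f + g \<in> Au p"
proof (rule AuI)
  show "holomorphic_on_lp_ball p (f + g)"
    unfolding holomorphic_on_lp_ball_def
  proof
    fix x assume x: "x \<in> lp_ball p"
    obtain L where L: "L \<in> lp_dual p" and Ld: "\<And>\<epsilon>. \<epsilon> > 0 \<Longrightarrow> \<exists>\<delta>>0. \<forall>h\<in>lp_space p.
        lp_norm p h < \<delta> \<longrightarrow> x + h \<in> lp_ball p \<longrightarrow> norm (f (x + h) - f x - L h) \<le> \<epsilon> * lp_norm p h"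
      using f x unfolding Au_def holomorphic_on_lp_ball_def by blast
    obtain M where M: "M \<in> lp_dual p" and Md: "\<And>\<epsilon>. \<epsilon> > 0 \<Longrightarrow> \<exists>\<delta>>0. \<forall>h\<in>lp_space p.
        lp_norm p h < \<delta> \<longrightarrow> x + h \<in> lp_ball p \<longrightarrow> norm (g (x + h) - g x - M h) \<le> \<epsilon> * lp_norm p h"
      using g x unfolding Au_def holomorphic_on_lp_ball_def by blast
    show "\<exists>L\<in>lp_dual p. \<forall>\<epsilon>>0. \<exists>\<delta>>0. \<forall>h\<in>lp_space p. lp_norm p h < \<delta> \<longrightarrow> x + h \<in> lp_ball p \<longrightarrow>
        norm ((f + g) (x + h) - (f + g) x - L h) \<le> \<epsilon> * lp_norm p h"
    proof (intro bexI[OF _ lp_dual_add[OF L M]] allI impI)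
      fix e :: real assume "e > 0"
      then have e: "e / 2 > 0" by simp
      obtain d1 where d1: "d1 > 0" "\<And>h. h \<in> lp_space p \<Longrightarrow> lp_norm p h < d1 \<Longrightarrow> x + h \<in> lp_ball p \<Longrightarrow>
          norm (f (x + h) - f x - L h) \<le> e / 2 * lp_norm p h"
        using Ld[OF e] by blast
      obtain d2 where d2: "d2 > 0" "\<And>h. h \<in> lp_space p \<Longrightarrow> lp_norm p h < d2 \<Longrightarrow> x + h \<in> lp_ball p \<Longrightarrow>
          norm (g (x + h) - g x - M h) \<le> e / 2 * lp_norm p h"
        using Md[OF e] by blast
      have "norm ((f + g) (x + h) - (f + g) x - (L h + M h)) \<le> e * lp_norm p h"
        if "h \<in> lp_space p" "lp_norm p h < min d1 d2" "x + h \<in> lp_ball p" for h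
      proof -
        have "norm ((f (x + h) - f x - L h) + (g (x + h) - g x - M h)) \<le> e * lp_norm p h"
          using norm_triangle_le[OF add_mono[OF d1(2) d2(2)], of h h] that by simp
        then show ?thesis by (simp add: algebra_simps)
      qed
      then show "\<exists>\<delta>>0. \<forall>h\<in>lp_space p. lp_norm p h < \<delta> \<longrightarrow> x + h \<in> lp_ball p \<longrightarrow>
          norm ((f + g) (x + h) - (f + g) x - (L h + M h)) \<le> e * lp_norm p h"
        using d1(1) d2(1) by (intro exI[of _ "min d1 d2"]) auto
    qed
  qed
  show "uniformly_continuous_on_lp_ball p (f + g)"
    unfolding uniformly_continuous_on_lp_ball_def
  proof (intro allI impI)
    fix e :: real assume "e > 0"
    then have e: "e / 2 > 0" by simp
    obtain d1 where d1: "d1 > 0" "\<And>x y. x \<in> lp_ball p \<Longrightarrow> y \<in> lp_ball p \<Longrightarrow> lp_norm p (x - y) < d1 \<Longrightarrow> norm (f x - f y) < e / 2"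
      using f e unfolding Au_def uniformly_continuous_on_lp_ball_def by blast
    obtain d2 where d2: "d2 > 0" "\<And>x y. x \<in> lp_ball p \<Longrightarrow> y \<in> lp_ball p \<Longrightarrow> lp_norm p (x - y) < d2 \<Longrightarrow> norm (g x - g y) < e / 2"
      using g e unfolding Au_def uniformly_continuous_on_lp_ball_def by blast
    have "norm ((f + g) x - (f + g) y) < e"
      if "x \<in> lp_ball p" "y \<in> lp_ball p" "lp_norm p (x - y) < min d1 d2" for x y
      using norm_diff_triangle_less[of "f x" "f y" "e / 2" "f y + g y - g x" "e / 2"]
        d1(2)[of x y] d2(2)[of x y] that norm_triangle_ineq[of "f x - f y" "g x - g y"]
      by (simp add: algebra_simps)
    then show "\<exists>\<delta>>0. \<forall>x\<in>lp_ball p. \<forall>y\<in>lp_ball p. lp_norm p (x - y) < \<delta> \<longrightarrow>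
        norm ((f + g) x - (f + g) y) < e"
      using d1(1) d2(1) by (intro exI[of _ "min d1 d2"]) auto
  qed
qed (simp add: Au_zero_outside[OF f] Au_zero_outside[OF g])

text \<open>Products are reduced to squares by polarization, so that \<open>Au_compose\<close> applies.\<close>

lemma Au_mult:
  assumes "1 \<le> p" "f \<in> Au p" "g \<in> Au p" shows "f * g \<in> Au p"
proof -
  have sq: "(\<lambda>x. (u x)\<^sup>2) \<in> Au p" if "u \<in> Au p" for u
  proof -
    have eq: "(\<lambda>x. (u x)\<^sup>2) = (\<lambda>x. if x \<in> lp_ball p then (u x)\<^sup>2 else 0)"
      using Au_zero_outside[OF that] by (intro ext) (metis zero_power2)
    show ?thesis
      unfolding eq
      by (rule Au_compose_entire[OF assms(1) that, where F = "\<lambda>w. w\<^sup>2"]) (intro holomorphic_intros)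
  qed
  have "f * g = (\<lambda>x. 1/4 * ((f + g) x)\<^sup>2) + (\<lambda>x. -1/4 * ((f + (\<lambda>x. -1 * g x)) x)\<^sup>2)"
    by (rule ext) (simp add: power2_eq_square field_simps)
  then show ?thesis
    using Au_add[OF Au_scale[OF assms(1) sq[OF Au_add[OF assms(2,3)]]]
        Au_scale[OF assms(1) sq[OF Au_add[OF assms(2) Au_scale[OF assms(1,3)]]]]]
    by (simp only:)
qed

text \<open>The values of f lie in a compact annulus that misses 0, on which inversion is
  holomorphic.\<close>

lemma Au_inverse:
  assumes "1 \<le> p" "f \<in> Au p" "0 < c" "\<And>x. x \<in> lp_ball p \<Longrightarrow> c \<le> norm (f x)"
  shows "(\<lambda>x. if x \<in> lp_ball p then inverse (f x) else 0) \<in> Au p"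
proof -
  obtain M where M: "\<And>x. norm (f x) \<le> M" using Au_bounded[OF assms(1,2)] by blast
  show ?thesis
  proof (rule Au_compose[OF assms(2), of inverse "- {0}" "cball 0 M - ball 0 c"])
    show "inverse holomorphic_on - {0 :: complex}" by (auto intro!: holomorphic_intros)
    show "compact (cball 0 M - ball 0 c :: complex set)" by (intro compact_diff) auto
  qed (use assms M in \<open>auto simp: not_less\<close>)
qed

lemma Au_affine:
  assumes "1 \<le> p" "f \<in> Au p"
  shows "(\<lambda>x. if x \<in> lp_ball p then c * f x + d else 0) \<in> Au p"
  by (rule Au_compose_entire[OF assms, where F = "\<lambda>w. c * w + d"]) (intro holomorphic_intros)

lemma Au_power:
  assumes "1 \<le> p" "f \<in> Au p"
  shows "(\<lambda>x. if x \<in> lp_ball p then f x ^ n else 0) \<in> Au p"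
  by (rule Au_compose_entire[OF assms, where F = "\<lambda>w. w ^ n"]) (intro holomorphic_intros)

lemma Au_exp:
  assumes "1 \<le> p" "f \<in> Au p"
  shows "(\<lambda>x. if x \<in> lp_ball p then exp (f x) else 0) \<in> Au p"
  by (rule Au_compose_entire[OF assms, where F = exp]) (intro holomorphic_intros)

lemma Au_coord:
  assumes "1 \<le> p" shows "(\<lambda>x. if x \<in> lp_ball p then x i else 0) \<in> Au p"
proof (rule AuI)
  have p: "0 < p" using assms by simp
  have c: "norm (h i) \<le> 1 * lp_norm p h" if "h \<in> lp_space p" for h
    using norm_coord_le_lp_norm[OF p that] by simp
  have L: "(\<lambda>h. h i) \<in> lp_dual p"
    unfolding lp_dual_def using c by fastforce
  show "holomorphic_on_lp_ball p (\<lambda>x. if x \<in> lp_ball p then x i else 0)"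
    unfolding holomorphic_on_lp_ball_def
  proof (intro ballI bexI[OF _ L] allI impI)
    fix x and e :: real assume "x \<in> lp_ball p" "e > 0"
    then show "\<exists>\<delta>>0. \<forall>h\<in>lp_space p. lp_norm p h < \<delta> \<longrightarrow> x + h \<in> lp_ball p \<longrightarrow>
        norm ((if x + h \<in> lp_ball p then (x + h) i else 0) - (if x \<in> lp_ball p then x i else 0) - h i)
        \<le> e * lp_norm p h"
      by (intro exI[of _ 1]) (auto simp: lp_norm_nonneg)
  qed
  show "uniformly_continuous_on_lp_ball p (\<lambda>x. if x \<in> lp_ball p then x i else 0)"
    unfolding uniformly_continuous_on_lp_ball_def
  proof (intro allI impI)
    fix e :: real assume e: "e > 0"
    have "norm (x i - y i) \<le> lp_norm p (x - y)" if "x \<in> lp_ball p" "y \<in> lp_ball p" for x y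
      using norm_coord_le_lp_norm[OF p lp_space_diff[OF p], of x y i] that lp_ball_subset by auto
    then show "\<exists>\<delta>>0. \<forall>x\<in>lp_ball p. \<forall>y\<in>lp_ball p. lp_norm p (x - y) < \<delta> \<longrightarrow>
        norm ((if x \<in> lp_ball p then x i else 0) - (if y \<in> lp_ball p then y i else 0)) < e"
      using e by (intro exI[of _ e]) fastforce
  qed
qed auto

lemma Au_linear_sum:
  assumes "1 \<le> p"
  shows "(\<lambda>x. if x \<in> lp_ball p then \<Sum>i<(m::nat). c i * x i else 0) \<in> Au p"
proof (induction m)
  case 0
  then show ?case using Au_const[of p 0] by (simp only: lessThan_0 sum.empty)
next
  case (Suc m)
  have "(\<lambda>x. if x \<in> lp_ball p then \<Sum>i<Suc m. c i * x i else 0) =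
      (\<lambda>x. if x \<in> lp_ball p then \<Sum>i<m. c i * x i else 0) +
      (\<lambda>x. c m * (if x \<in> lp_ball p then x m else 0))" by auto
  then show ?case
    using Au_add[OF Suc.IH Au_scale[OF assms Au_coord[OF assms, of m]]] by (simp only:)
qed

section \<open>Sums of coordinate powers over an index set\<close>

lemma suminf_norm_le_of_bound:
  fixes f :: "nat \<Rightarrow> 'a::banach"
  assumes "summable g" "\<And>j. norm (f j) \<le> g j"
  shows "norm (suminf f) \<le> suminf g"
proof -
  have s: "summable (\<lambda>j. norm (f j))"
    using assms by (intro summable_comparison_test'[OF assms(1)]) auto
  show ?thesis
    using summable_norm[OF s] suminf_le[OF assms(2) s assms(1)] by linarith
qed

lemma norm_power_diff_le:
  fixes u v :: complex
  assumes "norm u \<le> r" "norm v \<le> r"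
  shows "norm (u ^ n - v ^ n) \<le> real n * norm (u - v) * r ^ (n - 1)"
proof -
  have r0: "0 \<le> r" using assms norm_ge_zero order_trans by blast
  have "norm (\<Sum>i<n. v ^ (n - Suc i) * u ^ i) \<le> (\<Sum>i<n. r ^ (n - 1))"
  proof (rule sum_norm_le)
    fix i assume i: "i \<in> {..<n}"
    have "norm (v ^ (n - Suc i) * u ^ i) \<le> r ^ (n - Suc i) * r ^ i"
      unfolding norm_mult norm_power using assms r0 by (intro mult_mono power_mono) auto
    also have "\<dots> = r ^ (n - 1)" using i by (simp flip: power_add)
    finally show "norm (v ^ (n - Suc i) * u ^ i) \<le> r ^ (n - 1)" .
  qed
  then have "norm (u - v) * norm (\<Sum>i<n. v ^ (n - Suc i) * u ^ i) \<le> norm (u - v) * (real n * r ^ (n - 1))"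
    by (intro mult_left_mono) auto
  then show ?thesis by (simp add: power_diff_sumr2 norm_mult mult_ac)
qed

text \<open>The geometric sum for \<open>u ^ n - v ^ n\<close> gives one factor
  \<open>u - v\<close>; subtracting its value at \<open>u = v\<close> and expanding again gives the
  second. The quadratic remainder yields the derivative of the power sums, with \<open>n\<close>
  fixed, so the constant may be crude.\<close>

lemma norm_power_taylor_le:
  fixes u v :: complex
  assumes "norm u \<le> r" "norm v \<le> r"
  shows "norm (u ^ n - v ^ n - of_nat n * v ^ (n - 1) * (u - v)) \<le> (real n)\<^sup>2 * (norm (u - v))\<^sup>2 * r ^ (n - 2)"
proof -
  have r0: "0 \<le> r" using assms norm_ge_zero order_trans by blast
  have "of_nat n * v ^ (n - 1) = (\<Sum>i<n. v ^ (n - Suc i) * v ^ i)"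
    by (simp flip: power_add)
  then have "u ^ n - v ^ n - of_nat n * v ^ (n - 1) * (u - v)
      = (u - v) * ((\<Sum>i<n. v ^ (n - Suc i) * u ^ i) - (\<Sum>i<n. v ^ (n - Suc i) * v ^ i))"
    by (simp add: power_diff_sumr2 algebra_simps)
  also have "\<dots> = (u - v) * (\<Sum>i<n. v ^ (n - Suc i) * (u ^ i - v ^ i))"
    by (simp add: sum_subtractf algebra_simps)
  finally have eq: "u ^ n - v ^ n - of_nat n * v ^ (n - 1) * (u - v) = \<dots>" .
  have "norm (\<Sum>i<n. v ^ (n - Suc i) * (u ^ i - v ^ i)) \<le> (\<Sum>i<n. real n * norm (u - v) * r ^ (n - 2))"
  proof (rule sum_norm_le)
    fix i assume i: "i \<in> {..<n}"
    show "norm (v ^ (n - Suc i) * (u ^ i - v ^ i)) \<le> real n * norm (u - v) * r ^ (n - 2)"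
    proof (cases i)
      \<comment> \<open>Split off because \<open>i - 1\<close> is truncated at 0; the difference of
        the powers is 0 here.\<close>
      case 0
      then show ?thesis using r0 by simp
    next
      case (Suc l)
      have "norm (v ^ (n - Suc i) * (u ^ i - v ^ i)) \<le> r ^ (n - Suc i) * (real i * norm (u - v) * r ^ (i - 1))"
        unfolding norm_mult norm_power
        using assms r0 norm_power_diff_le[OF assms] by (intro mult_mono power_mono) auto
      also have "\<dots> = real i * norm (u - v) * (r ^ (n - Suc i) * r ^ (i - 1))" by simp
      also have "r ^ (n - Suc i) * r ^ (i - 1) = r ^ (n - 2)" using i Suc by (simp flip: power_add)
      also have "real i * norm (u - v) * r ^ (n - 2) \<le> real n * norm (u - v) * r ^ (n - 2)"
        using i r0 by (intro mult_right_mono) auto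
      finally show ?thesis .
    qed
  qed
  then have "norm (u - v) * norm (\<Sum>i<n. v ^ (n - Suc i) * (u ^ i - v ^ i)) \<le>
      norm (u - v) * (real n * (real n * norm (u - v) * r ^ (n - 2)))"
    by (intro mult_left_mono) auto
  then show ?thesis unfolding eq by (simp add: norm_mult power2_eq_square mult_ac)
qed

lemma power_le_powr:
  fixes a :: real
  assumes "0 \<le> a" "a \<le> 1" "0 < p" "p \<le> real n"
  shows "a ^ n \<le> a powr p"
proof (cases "a = 0")
  case True
  then show ?thesis using assms by (cases n) auto
next
  case False
  then have "a ^ n = a powr real n" using assms by (simp add: powr_realpow)
  also have "\<dots> \<le> a powr p" using assms False by (intro powr_mono') auto
  finally show ?thesis .
qed

lemma norm_coord_le_1:
  assumes "0 < p" "x \<in> lp_ball p" shows "norm (x i) \<le> 1"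
  using norm_coord_le_lp_norm[of p x i] assms by (simp add: lp_ball_def)

lemma lp_summable: "x \<in> lp_space p \<Longrightarrow> summable (\<lambda>i. norm (x i) powr p)"
  by (simp add: lp_space_def)

lemma lp_suminf_powr_less_1: "0 < p \<Longrightarrow> x \<in> lp_ball p \<Longrightarrow> (\<Sum>i. norm (x i) powr p) < 1"
  by (simp add: mem_lp_ball_iff)

lemma lp_power_summable:
  assumes "0 < p" "x \<in> lp_ball p" "p \<le> real n"
  shows "summable (\<lambda>j. if j \<in> A then x j ^ n else 0)"
  using lp_summable[OF lp_ball_subset[OF assms(2)]]
proof (rule summable_comparison_test')
  show "norm (if j \<in> A then x j ^ n else 0) \<le> norm (x j) powr p" for j
    using power_le_powr[of "norm (x j)" p n] norm_coord_le_1[OF assms(1,2)] assms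
    by (auto simp: norm_power)
qed

text \<open>On the ball \<open>norm (x j) powr p\<close> dominates exponents from p upwards. The
  Lipschitz bound works with exponent \<open>n - 1\<close> and the Taylor remainder with
  \<open>n - 2\<close>, which is the origin of the condition on \<open>n\<close>.\<close>

lemma Au_power_sum:
  assumes p: "1 \<le> p" and n: "p + 2 \<le> real n"
  shows "(\<lambda>x. if x \<in> lp_ball p then \<Sum>j. if j \<in> A then x j ^ n else 0 else 0) \<in> Au p"
proof (rule AuI)
  have p0: "0 < p" using p by simp
  have pn: "p \<le> real n" "p \<le> real (n - 1)" "p \<le> real (n - 2)" using n p by auto
  let ?Q = "\<lambda>x. \<Sum>j. if j \<in> A then x j ^ n else 0"
  \<comment> \<open>A common majorant for both points: it dominates the \<open>k\<close>-th power of
    the larger coordinate for every \<open>k\<close> at least p, and its sum is at most 2 for all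
    points of the ball.\<close>
  define S where "S x y j = norm (x j) powr p + norm (y j) powr p" for x y :: "nat \<Rightarrow> complex" and j
  have S: "summable (S x y)" "suminf (S x y) \<le> 2" if "x \<in> lp_ball p" "y \<in> lp_ball p" for x y
  proof -
    note s = lp_summable[OF lp_ball_subset[OF that(1)]] lp_summable[OF lp_ball_subset[OF that(2)]]
    show "summable (S x y)" unfolding S_def using s by (rule summable_add)
    show "suminf (S x y) \<le> 2" unfolding S_def suminf_add[OF s, symmetric]
      using lp_suminf_powr_less_1[OF p0 that(1)] lp_suminf_powr_less_1[OF p0 that(2)] by linarith
  qed
  have max_le: "max (norm (x j)) (norm (y j)) ^ k \<le> S x y j"
    if "x \<in> lp_ball p" "y \<in> lp_ball p" "p \<le> real k" for x y j k
    using power_le_powr[of "norm (x j)" p k] power_le_powr[of "norm (y j)" p k]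
      norm_coord_le_1[OF p0 that(1)] norm_coord_le_1[OF p0 that(2)] that p0
    by (auto simp: S_def max_def intro: order_trans)
  have qs: "summable (\<lambda>j. if j \<in> A then x j ^ n else 0)" if "x \<in> lp_ball p" for x
    by (rule lp_power_summable[OF p0 that pn(1)])
  have coord: "norm (h j) \<le> lp_norm p h" if "h \<in> lp_space p" for h j
    by (rule norm_coord_le_lp_norm[OF p0 that])
  show "uniformly_continuous_on_lp_ball p (\<lambda>x. if x \<in> lp_ball p then ?Q x else 0)"
    unfolding uniformly_continuous_on_lp_ball_def
  proof (intro allI impI)
    fix e :: real assume e: "e > 0"
    have lip: "norm (?Q x - ?Q y) \<le> real n * lp_norm p (x - y) * 2" if xy: "x \<in> lp_ball p" "y \<in> lp_ball p" for x y
    proof -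
      let ?d = "lp_norm p (x - y)"
      have d: "x - y \<in> lp_space p" using xy lp_space_diff[OF p0] lp_ball_subset by blast
      have "norm (?Q x - ?Q y) = norm (\<Sum>j. (if j \<in> A then x j ^ n else 0) - (if j \<in> A then y j ^ n else 0))"
        using suminf_diff[OF qs[OF xy(1)] qs[OF xy(2)]] by simp
      also have "\<dots> \<le> (\<Sum>j. real n * ?d * S x y j)"
      proof (rule suminf_norm_le_of_bound)
        show "summable (\<lambda>j. real n * ?d * S x y j)" using S(1)[OF xy] by (rule summable_mult)
        fix j
        have "norm (x j ^ n - y j ^ n) \<le> real n * norm (x j - y j) * max (norm (x j)) (norm (y j)) ^ (n - 1)"
          by (rule norm_power_diff_le) auto
        also have "\<dots> \<le> real n * ?d * S x y j"
          using coord[OF d, of j] max_le[OF xy pn(2)] lp_norm_nonneg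
          by (intro mult_mono) (auto intro!: zero_le_power simp: le_max_iff_disj)
        finally have "norm (x j ^ n - y j ^ n) \<le> real n * ?d * S x y j" .
        moreover have "0 \<le> real n * ?d * S x y j" by (simp add: S_def lp_norm_nonneg)
        ultimately show "norm ((if j \<in> A then x j ^ n else 0) - (if j \<in> A then y j ^ n else 0)) \<le> real n * ?d * S x y j"
          by auto
      qed
      also have "\<dots> = real n * ?d * suminf (S x y)" by (rule suminf_mult[OF S(1)[OF xy]])
      also have "\<dots> \<le> real n * ?d * 2"
        using S(2)[OF xy] lp_norm_nonneg by (intro mult_left_mono) auto
      finally show ?thesis .
    qed
    show "\<exists>\<delta>>0. \<forall>x\<in>lp_ball p. \<forall>y\<in>lp_ball p. lp_norm p (x - y) < \<delta> \<longrightarrow>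
        norm ((if x \<in> lp_ball p then ?Q x else 0) - (if y \<in> lp_ball p then ?Q y else 0)) < e"
    proof (intro exI[of _ "e / (2 * real n)"] conjI ballI impI)
      show "0 < e / (2 * real n)" using e n p by (cases n) auto
      fix x y assume xy: "x \<in> lp_ball p" "y \<in> lp_ball p" "lp_norm p (x - y) < e / (2 * real n)"
      have "real n * lp_norm p (x - y) * 2 < e" using xy(3) n p by (cases n) (auto simp: field_simps)
      then show "norm ((if x \<in> lp_ball p then ?Q x else 0) - (if y \<in> lp_ball p then ?Q y else 0)) < e"
        using lip[OF xy(1,2)] xy(1,2) by simp
    qed
  qed
  show "holomorphic_on_lp_ball p (\<lambda>x. if x \<in> lp_ball p then ?Q x else 0)"
    unfolding holomorphic_on_lp_ball_def
  proof
    fix x assume x: "x \<in> lp_ball p"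
    \<comment> \<open>The termwise derivative. Coordinates of h are bounded by its norm, so
      summability comes from x alone.\<close>
    define l where "l h j = (if j \<in> A then of_nat n * x j ^ (n - 1) * h j else 0)" for h :: "nat \<Rightarrow> complex" and j
    have lb: "norm (l h j) \<le> real n * lp_norm p h * norm (x j) powr p" if "h \<in> lp_space p" for h j
    proof (cases "j \<in> A")
      case True
      have "norm (l h j) = real n * norm (h j) * norm (x j) ^ (n - 1)"
        using True by (simp add: l_def norm_mult norm_power)
      also have "\<dots> \<le> real n * lp_norm p h * norm (x j) powr p"
        using coord[OF that] power_le_powr[of "norm (x j)" p "n - 1"] norm_coord_le_1[OF p0 x] pn p0 lp_norm_nonneg
        by (intro mult_mono) auto
      finally show ?thesis .
    qed (simp add: l_def lp_norm_nonneg)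
    have sx: "summable (\<lambda>j. norm (x j) powr p)" using lp_summable[OF lp_ball_subset[OF x]] .
    have ls: "summable (l h)" if "h \<in> lp_space p" for h
      using summable_mult[OF sx] by (rule summable_comparison_test') (rule lb[OF that])
    have L: "(\<lambda>h. suminf (l h)) \<in> lp_dual p"
    proof -
      have "suminf (l (h + k)) = suminf (l h) + suminf (l k)" if "h \<in> lp_space p" "k \<in> lp_space p" for h k
        unfolding suminf_add[OF ls[OF that(1)] ls[OF that(2)]]
        by (rule suminf_cong) (simp add: l_def algebra_simps)
      moreover have "suminf (l (\<lambda>i. c * h i)) = c * suminf (l h)" if "h \<in> lp_space p" for h c
        unfolding suminf_mult[OF ls[OF that], symmetric]
        by (rule suminf_cong) (simp add: l_def)
      moreover have "norm (suminf (l h)) \<le> real n * lp_norm p h" if h: "h \<in> lp_space p" for h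
      proof -
        have "norm (suminf (l h)) \<le> (\<Sum>j. real n * lp_norm p h * norm (x j) powr p)"
          by (rule suminf_norm_le_of_bound[OF summable_mult[OF sx] lb[OF h]])
        also have "\<dots> = real n * lp_norm p h * (\<Sum>j. norm (x j) powr p)" by (rule suminf_mult[OF sx])
        also have "\<dots> \<le> real n * lp_norm p h * 1"
          using lp_suminf_powr_less_1[OF p0 x] lp_norm_nonneg by (intro mult_left_mono) auto
        finally show ?thesis by simp
      qed
      ultimately show ?thesis unfolding lp_dual_def by blast
    qed
    show "\<exists>L\<in>lp_dual p. \<forall>\<epsilon>>0. \<exists>\<delta>>0. \<forall>h\<in>lp_space p. lp_norm p h < \<delta> \<longrightarrow> x + h \<in> lp_ball p \<longrightarrow>
        norm ((if x + h \<in> lp_ball p then ?Q (x + h) else 0) - (if x \<in> lp_ball p then ?Q x else 0) - L h) \<le> \<epsilon> * lp_norm p h"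
    proof (intro bexI[OF _ L] allI impI)
      fix e :: real assume e: "e > 0"
      have tay: "norm (?Q (x + h) - ?Q x - suminf (l h)) \<le> (2 * (real n)\<^sup>2 * lp_norm p h) * lp_norm p h"
        if h: "h \<in> lp_space p" "x + h \<in> lp_ball p" for h
      proof -
        let ?S = "S (x + h) x" and ?d = "lp_norm p h"
        have "?Q (x + h) - ?Q x - suminf (l h) =
            (\<Sum>j. (if j \<in> A then (x + h) j ^ n else 0) - (if j \<in> A then x j ^ n else 0) - l h j)"
          using suminf_diff[OF summable_diff[OF qs[OF h(2)] qs[OF x]] ls[OF h(1)]]
            suminf_diff[OF qs[OF h(2)] qs[OF x]] by simp
        also have "norm \<dots> \<le> (\<Sum>j. (real n)\<^sup>2 * ?d\<^sup>2 * ?S j)"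
        proof (rule suminf_norm_le_of_bound)
          show "summable (\<lambda>j. (real n)\<^sup>2 * ?d\<^sup>2 * ?S j)" using S(1)[OF h(2) x] by (rule summable_mult)
          fix j
          have "norm ((x + h) j ^ n - x j ^ n - of_nat n * x j ^ (n - 1) * ((x + h) j - x j))
            \<le> (real n)\<^sup>2 * (norm ((x + h) j - x j))\<^sup>2 * max (norm ((x + h) j)) (norm (x j)) ^ (n - 2)"
            by (rule norm_power_taylor_le) auto
          also have "\<dots> \<le> (real n)\<^sup>2 * ?d\<^sup>2 * ?S j"
            using coord[OF h(1), of j] max_le[OF h(2) x pn(3), of j] lp_norm_nonneg
            by (intro mult_mono power_mono) (auto intro!: zero_le_power simp: le_max_iff_disj)
          finally have "norm ((x + h) j ^ n - x j ^ n - of_nat n * x j ^ (n - 1) * h j) \<le> (real n)\<^sup>2 * ?d\<^sup>2 * ?S j"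
            by simp
          moreover have "0 \<le> (real n)\<^sup>2 * ?d\<^sup>2 * ?S j" by (simp add: S_def)
          ultimately show "norm ((if j \<in> A then (x + h) j ^ n else 0) - (if j \<in> A then x j ^ n else 0) - l h j)
              \<le> (real n)\<^sup>2 * ?d\<^sup>2 * ?S j"
            by (auto simp: l_def)
        qed
        also have "\<dots> = (real n)\<^sup>2 * ?d\<^sup>2 * suminf ?S" by (rule suminf_mult[OF S(1)[OF h(2) x]])
        also have "\<dots> \<le> (real n)\<^sup>2 * ?d\<^sup>2 * 2"
          using S(2)[OF h(2) x] by (intro mult_left_mono) auto
        finally show ?thesis by (simp add: power2_eq_square mult_ac)
      qed
      show "\<exists>\<delta>>0. \<forall>h\<in>lp_space p. lp_norm p h < \<delta> \<longrightarrow> x + h \<in> lp_ball p \<longrightarrow>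
        norm ((if x + h \<in> lp_ball p then ?Q (x + h) else 0) - (if x \<in> lp_ball p then ?Q x else 0) - suminf (l h)) \<le> e * lp_norm p h"
      proof (intro exI[of _ "e / (2 * (real n)\<^sup>2)"] conjI ballI impI)
        show "0 < e / (2 * (real n)\<^sup>2)" using e n p by (cases n) auto
        fix h assume h: "h \<in> lp_space p" "lp_norm p h < e / (2 * (real n)\<^sup>2)" "x + h \<in> lp_ball p"
        have "2 * (real n)\<^sup>2 * lp_norm p h \<le> e" using h(2) n p by (cases n) (auto simp: field_simps)
        then have "(2 * (real n)\<^sup>2 * lp_norm p h) * lp_norm p h \<le> e * lp_norm p h"
          by (intro mult_right_mono lp_norm_nonneg)
        then show "norm ((if x + h \<in> lp_ball p then ?Q (x + h) else 0) - (if x \<in> lp_ball p then ?Q x else 0) - suminf (l h)) \<le> e * lp_norm p h"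
          using tay[OF h(1,3)] h(3) x by simp
      qed
    qed
  qed
qed auto

section \<open>Boundary values\<close>

lemma eventually_lp_nhds_ball:
  "eventually P (lp_nhds_ball p x) \<longleftrightarrow> (\<exists>e>0. \<forall>y\<in>lp_ball p. lp_norm p (y - x) < e \<longrightarrow> P y)"
  unfolding lp_nhds_ball_def
proof (subst eventually_INF_base)
  fix a b :: real assume "a \<in> {0<..}" "b \<in> {0<..}"
  then show "\<exists>c\<in>{0<..}. principal {y \<in> lp_ball p. lp_norm p (y - x) < c}
      \<le> inf (principal {y \<in> lp_ball p. lp_norm p (y - x) < a}) (principal {y \<in> lp_ball p. lp_norm p (y - x) < b})"
    by (intro bexI[of _ "min a b"]) auto
qed (auto simp: eventually_principal)

lemma filterlim_radial:
  assumes "0 < p" "x \<in> lp_space p" "lp_norm p x \<le> 1"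
  shows "filterlim (\<lambda>r i. of_real r * x i) (lp_nhds_ball p x) (at_left (1::real))"
  unfolding filterlim_iff
proof (intro allI impI)
  fix P assume "eventually P (lp_nhds_ball p x)"
  then obtain e where e: "e > 0" "\<And>y. y \<in> lp_ball p \<Longrightarrow> lp_norm p (y - x) < e \<Longrightarrow> P y"
    unfolding eventually_lp_nhds_ball by blast
  have "P (\<lambda>i. of_real r * x i)" if r: "max 0 (1 - e) < r" "r < 1" for r
  proof (rule e(2))
    show "(\<lambda>i. of_real r * x i) \<in> lp_ball p" using r by (intro lp_ball_scale assms) auto
    have "lp_norm p ((\<lambda>i. of_real r * x i) - x) = \<bar>r - 1\<bar> * lp_norm p x"
      using lp_norm_scale_diff[OF assms(1,2), of r 1] by simp
    also have "\<dots> \<le> \<bar>r - 1\<bar> * 1" using assms by (intro mult_left_mono) auto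
    also have "\<dots> < e" using r by auto
    finally show "lp_norm p ((\<lambda>i. of_real r * x i) - x) < e" .
  qed
  then show "\<forall>\<^sub>F r in at_left 1. P (\<lambda>i. of_real r * x i)"
    using e(1) by (intro eventually_at_leftI[of "max 0 (1 - e)"]) auto
qed

text \<open>The shrunken copies of x lie in the ball and tend to x, also when x is on the unit
  sphere; limits along the filter are therefore unique.\<close>

lemma lp_nhds_ball_neq_bot:
  assumes "0 < p" "x \<in> lp_space p" "lp_norm p x \<le> 1"
  shows "lp_nhds_ball p x \<noteq> bot"
proof
  assume "lp_nhds_ball p x = bot"
  then have "eventually (\<lambda>_. False) (at_left (1::real))"
    using filterlim_radial[OF assms] unfolding filterlim_iff by (auto dest: spec[of _ "\<lambda>_. False"])
  then show False by (simp add: trivial_limit_at_left_real)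
qed

lemma Au_cauchy:
  assumes "1 \<le> p" "f \<in> Au p" "x \<in> lp_space p" "0 < e"
  obtains d where "0 < d" "\<And>y y'. y \<in> lp_ball p \<Longrightarrow> y' \<in> lp_ball p \<Longrightarrow>
    lp_norm p (y - x) < d \<Longrightarrow> lp_norm p (y' - x) < d \<Longrightarrow> norm (f y - f y') < e"
proof -
  obtain d where d: "0 < d"
    "\<And>x y. x \<in> lp_ball p \<Longrightarrow> y \<in> lp_ball p \<Longrightarrow> lp_norm p (x - y) < d \<Longrightarrow> norm (f x - f y) < e"
    using assms(2,4) unfolding Au_def uniformly_continuous_on_lp_ball_def by blast
  show thesis
    using d lp_norm_diff_less[OF assms(1) lp_ball_subset lp_ball_subset assms(3), of _ _ "d / 4"]
    by (intro that[of "d / 4"]) auto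
qed

text \<open>Certifies that the \<open>Lim\<close> in the definition of the extension is an actual
  limit. Uniform continuity makes f Cauchy near x, completeness of the complex numbers gives a limit
  along one radial sequence, and the same Cauchy estimate carries it over to the whole
  filter.\<close>

lemma Au_tendsto_extension:
  assumes "1 \<le> p" "f \<in> Au p" "x \<in> lp_space p" "lp_norm p x \<le> 1"
  shows "(f \<longlongrightarrow> Au_extension p f x) (lp_nhds_ball p x)"
proof -
  have p: "0 < p" using assms by simp
  define X where "X n = (\<lambda>i. of_real (1 - inverse (real (Suc n))) * x i)" for n
  have "filterlim (\<lambda>n. 1 - inverse (real (Suc n))) (at_left 1) sequentially"
    using tendsto_diff[OF tendsto_const LIMSEQ_inverse_real_of_nat, of 1]
    unfolding filterlim_at by auto
  then have X: "filterlim X (lp_nhds_ball p x) sequentially"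
    unfolding X_def by (rule filterlim_compose[OF filterlim_radial[OF p assms(3,4)]])
  have Xe: "\<forall>\<^sub>F n in sequentially. X n \<in> lp_ball p \<and> lp_norm p (X n - x) < d" if "d > 0" for d
  proof -
    have "\<forall>\<^sub>F y in lp_nhds_ball p x. y \<in> lp_ball p \<and> lp_norm p (y - x) < d"
      using that unfolding eventually_lp_nhds_ball by auto
    then show ?thesis using X unfolding filterlim_iff by blast
  qed
  have "Cauchy (\<lambda>n. f (X n))"
    unfolding Cauchy_def
  proof (intro allI impI)
    fix e :: real assume "e > 0"
    then obtain d where d: "0 < d" "\<And>y y'. y \<in> lp_ball p \<Longrightarrow> y' \<in> lp_ball p \<Longrightarrow>
      lp_norm p (y - x) < d \<Longrightarrow> lp_norm p (y' - x) < d \<Longrightarrow> norm (f y - f y') < e"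
      using Au_cauchy[OF assms(1-3)] by blast
    obtain M where "\<And>n. n \<ge> M \<Longrightarrow> X n \<in> lp_ball p \<and> lp_norm p (X n - x) < d"
      using Xe[OF d(1)] unfolding eventually_sequentially by blast
    then show "\<exists>M. \<forall>m\<ge>M. \<forall>n\<ge>M. dist (f (X m)) (f (X n)) < e"
      using d(2) unfolding dist_norm by blast
  qed
  then obtain l where l: "(\<lambda>n. f (X n)) \<longlonglongrightarrow> l"
    using Cauchy_convergent_iff convergent_def by blast
  have "(f \<longlongrightarrow> l) (lp_nhds_ball p x)"
  proof (rule tendstoI)
    fix e :: real assume "e > 0"
    then have "e / 2 > 0" by simp
    then obtain d where d: "0 < d" "\<And>y y'. y \<in> lp_ball p \<Longrightarrow> y' \<in> lp_ball p \<Longrightarrow>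
      lp_norm p (y - x) < d \<Longrightarrow> lp_norm p (y' - x) < d \<Longrightarrow> norm (f y - f y') < e / 2"
      using Au_cauchy[OF assms(1-3)] by blast
    have "dist (f y) l < e" if y: "y \<in> lp_ball p" "lp_norm p (y - x) < d" for y
    proof -
      have "norm (f y - l) \<le> e / 2"
      proof (rule tendsto_upperbound)
        show "(\<lambda>n. norm (f y - f (X n))) \<longlonglongrightarrow> norm (f y - l)" by (intro tendsto_intros l)
        show "\<forall>\<^sub>F n in sequentially. norm (f y - f (X n)) \<le> e / 2"
          using Xe[OF d(1)] by eventually_elim (use d(2) y in \<open>auto intro!: less_imp_le\<close>)
      qed simp
      then show ?thesis using \<open>e > 0\<close> by (simp add: dist_norm)
    qed
    then show "\<forall>\<^sub>F y in lp_nhds_ball p x. dist (f y) l < e"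
      unfolding eventually_lp_nhds_ball using d(1) by blast
  qed
  then show ?thesis
    unfolding Au_extension_def using tendsto_Lim[OF lp_nhds_ball_neq_bot[OF p assms(3,4)]] by metis
qed

lemma Au_radial_limit:
  assumes "1 \<le> p" "f \<in> Au p" "x \<in> lp_space p" "lp_norm p x \<le> 1"
  shows "((\<lambda>r. f (\<lambda>i. of_real r * x i)) \<longlongrightarrow> Au_extension p f x) (at_left (1::real))"
  by (rule filterlim_compose[OF Au_tendsto_extension[OF assms] filterlim_radial]) (use assms in auto)

lemma Au_extension_ball:
  assumes "1 \<le> p" "f \<in> Au p" "x \<in> lp_ball p"
  shows "Au_extension p f x = f x"
proof -
  have x: "x \<in> lp_space p" "lp_norm p x \<le> 1" using assms by (auto simp: lp_ball_def)
  have "(f \<longlongrightarrow> f x) (lp_nhds_ball p x)"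
  proof (rule tendstoI)
    fix e :: real assume "e > 0"
    then show "\<forall>\<^sub>F y in lp_nhds_ball p x. dist (f y) (f x) < e"
      using assms unfolding eventually_lp_nhds_ball dist_norm Au_def uniformly_continuous_on_lp_ball_def by blast
  qed
  moreover have "lp_nhds_ball p x \<noteq> bot" using lp_nhds_ball_neq_bot assms x by auto
  ultimately show ?thesis unfolding Au_extension_def by (metis tendsto_Lim)
qed

text \<open>The gain is uniformity: \<open>d\<close> comes from the modulus of continuity of f and
  serves all x of the closed ball at once. Later x runs through boundary points that vary with
  m.\<close>

lemma Au_extension_near:
  assumes "1 \<le> p" "f \<in> Au p" "0 < e"
  obtains d where "0 < d" "\<And>x y. x \<in> lp_space p \<Longrightarrow> lp_norm p x \<le> 1 \<Longrightarrow> y \<in> lp_ball p \<Longrightarrow>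
    lp_norm p (y - x) < d \<Longrightarrow> norm (f y - Au_extension p f x) \<le> e"
proof -
  obtain d where d: "0 < d"
    "\<And>x y. x \<in> lp_ball p \<Longrightarrow> y \<in> lp_ball p \<Longrightarrow> lp_norm p (x - y) < d \<Longrightarrow> norm (f x - f y) < e"
    using assms(2,3) unfolding Au_def uniformly_continuous_on_lp_ball_def by blast
  have "norm (f y - Au_extension p f x) \<le> e"
    if x: "x \<in> lp_space p" "lp_norm p x \<le> 1" and y: "y \<in> lp_ball p" "lp_norm p (y - x) < d / 4" for x y
  proof (rule tendsto_upperbound)
    show "((\<lambda>w. norm (f y - f w)) \<longlongrightarrow> norm (f y - Au_extension p f x)) (lp_nhds_ball p x)"
      by (intro tendsto_intros Au_tendsto_extension assms x)
    have "norm (f y - f w) \<le> e" if "w \<in> lp_ball p" "lp_norm p (w - x) < d / 4" for w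
      using d(2)[OF y(1) that(1)] lp_norm_diff_less[OF assms(1) lp_ball_subset[OF y(1)] lp_ball_subset[OF that(1)] x(1) y(2) that(2)]
      by simp
    then show "\<forall>\<^sub>F w in lp_nhds_ball p x. norm (f y - f w) \<le> e"
      unfolding eventually_lp_nhds_ball using d(1) by (intro exI[of _ "d / 4"]) auto
    show "lp_nhds_ball p x \<noteq> bot" using lp_nhds_ball_neq_bot x assms by auto
  qed
  then show thesis using d(1) that[of "d / 4"] by auto
qed

section \<open>Characters\<close>

lemma spectrum_add: "\<theta> \<in> Au_spectrum p \<Longrightarrow> f \<in> Au p \<Longrightarrow> g \<in> Au p \<Longrightarrow> \<theta> (f + g) = \<theta> f + \<theta> g"
  and spectrum_scale: "\<theta> \<in> Au_spectrum p \<Longrightarrow> f \<in> Au p \<Longrightarrow> \<theta> (\<lambda>x. c * f x) = c * \<theta> f"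
  and spectrum_mult: "\<theta> \<in> Au_spectrum p \<Longrightarrow> f \<in> Au p \<Longrightarrow> g \<in> Au p \<Longrightarrow> \<theta> (f * g) = \<theta> f * \<theta> g"
  by (auto simp: Au_spectrum_def)

lemma spectrum_one:
  assumes "\<theta> \<in> Au_spectrum p" shows "\<theta> (\<lambda>x. if x \<in> lp_ball p then 1 else 0) = 1"
proof -
  obtain f where f: "f \<in> Au p" "\<theta> f \<noteq> 0" using assms by (auto simp: Au_spectrum_def)
  have "f * (\<lambda>x. if x \<in> lp_ball p then 1 else 0) = f"
    using Au_zero_outside[OF f(1)] by (intro ext) simp
  then show ?thesis using spectrum_mult[OF assms f(1) Au_const[of p 1]] f(2) by simp
qed

lemma spectrum_affine:
  assumes "1 \<le> p" "\<theta> \<in> Au_spectrum p" "f \<in> Au p"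
  shows "\<theta> (\<lambda>x. if x \<in> lp_ball p then c * f x + d else 0) = c * \<theta> f + d"
proof -
  let ?one = "\<lambda>x. if x \<in> lp_ball p then 1 else 0 :: complex"
  have "(\<lambda>x. if x \<in> lp_ball p then c * f x + d else 0) = (\<lambda>x. c * f x) + (\<lambda>x. d * ?one x)"
    using Au_zero_outside[OF assms(3)] by (intro ext) simp
  then show ?thesis
    using spectrum_add[OF assms(2) Au_scale[OF assms(1,3)] Au_scale[OF assms(1) Au_const[of p 1]], of c d]
      spectrum_scale[OF assms(2,3)] spectrum_scale[OF assms(2) Au_const[of p 1], of d] spectrum_one[OF assms(2)]
    by simp
qed

lemma spectrum_power:
  assumes "1 \<le> p" "\<theta> \<in> Au_spectrum p" "f \<in> Au p"
  shows "\<theta> (\<lambda>x. if x \<in> lp_ball p then f x ^ n else 0) = \<theta> f ^ n"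
proof (induction n)
  case 0
  then show ?case using spectrum_one[OF assms(2)] by (simp only: power_0)
next
  case (Suc n)
  have "(\<lambda>x. if x \<in> lp_ball p then f x ^ Suc n else 0) = f * (\<lambda>x. if x \<in> lp_ball p then f x ^ n else 0)"
    by auto
  then show ?case
    using spectrum_mult[OF assms(2,3) Au_power[OF assms(1,3)], of n] Suc by simp
qed

lemma spectrum_inverse:
  assumes "1 \<le> p" "\<theta> \<in> Au_spectrum p" "f \<in> Au p" "0 < c" "\<And>x. x \<in> lp_ball p \<Longrightarrow> c \<le> norm (f x)"
  shows "\<theta> f \<noteq> 0" "\<theta> (\<lambda>x. if x \<in> lp_ball p then inverse (f x) else 0) = inverse (\<theta> f)"
proof -
  let ?g = "\<lambda>x. if x \<in> lp_ball p then inverse (f x) else 0"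
  have "f x \<noteq> 0" if "x \<in> lp_ball p" for x using assms(5)[OF that] assms(4) by auto
  then have "f * ?g = (\<lambda>x. if x \<in> lp_ball p then 1 else 0)" by (intro ext) simp
  then have "\<theta> f * \<theta> ?g = 1"
    using spectrum_mult[OF assms(2,3) Au_inverse[OF assms(1,3,4,5)]] spectrum_one[OF assms(2)] by simp
  then show "\<theta> f \<noteq> 0" "\<theta> ?g = inverse (\<theta> f)" using inverse_unique by force+
qed

text \<open>If \<theta> f exceeded M in modulus, f minus the constant \<theta> f would be bounded
  away from 0 on the ball and hence invertible in the algebra, although \<theta> annihilates
  it.\<close>

lemma spectrum_contractive:
  assumes "1 \<le> p" "\<theta> \<in> Au_spectrum p" "f \<in> Au p" "\<And>x. x \<in> lp_ball p \<Longrightarrow> norm (f x) \<le> M"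
  shows "norm (\<theta> f) \<le> M"
proof (rule ccontr)
  assume "\<not> norm (\<theta> f) \<le> M"
  then have M: "0 < norm (\<theta> f) - M" by simp
  let ?g = "\<lambda>x. if x \<in> lp_ball p then 1 * f x + (- \<theta> f) else 0"
  have "\<theta> ?g \<noteq> 0"
  proof (rule spectrum_inverse(1)[OF assms(1,2) Au_affine[OF assms(1,3)] M])
    fix x assume x: "x \<in> lp_ball p"
    show "norm (\<theta> f) - M \<le> norm (?g x)"
      using assms(4)[OF x] norm_triangle_ineq2[of "\<theta> f" "f x"] x by (simp add: norm_minus_commute)
  qed
  then show False using spectrum_affine[OF assms(1-3), of 1 "- \<theta> f"] by simp
qed

lemma spectrum_dist_ge:
  assumes "1 \<le> p" "\<phi> \<in> Au_spectrum p" "\<psi> \<in> Au_spectrum p" "f \<in> Au p"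
    "\<And>x. x \<in> lp_ball p \<Longrightarrow> norm (f x) \<le> 1"
  shows "norm (\<phi> f - \<psi> f) \<le> spectrum_dist p \<phi> \<psi>"
  unfolding spectrum_dist_def
proof (rule cSUP_upper)
  have ne: "lp_ball p \<noteq> {}" using zero_in_lp_ball by blast
  show "f \<in> {f \<in> Au p. Au_norm p f \<le> 1}"
    using assms(4,5) ne by (auto simp: Au_norm_def intro!: cSUP_least)
  \<comment> \<open>A real \<open>SUP\<close> is known to dominate its members only if they are
    bounded above. Boundedness of g takes care of \<open>Au_norm\<close>, contractivity then of the
    distance.\<close>
  have "norm (\<phi> g - \<psi> g) \<le> 2" if g: "g \<in> Au p" "Au_norm p g \<le> 1" for g
  proof -
    obtain M where "\<And>x. norm (g x) \<le> M" using Au_bounded[OF assms(1) g(1)] by blast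
    then have "bdd_above ((\<lambda>x. norm (g x)) ` lp_ball p)" by (intro bdd_aboveI2)
    then have "norm (g x) \<le> 1" if "x \<in> lp_ball p" for x
      using cSUP_upper[OF that, of "\<lambda>x. norm (g x)"] g(2) by (simp add: Au_norm_def)
    then have "norm (\<phi> g) \<le> 1" "norm (\<psi> g) \<le> 1"
      using spectrum_contractive[OF assms(1)] assms(2,3) g(1) by blast+
    then show ?thesis using norm_triangle_ineq4[of "\<phi> g" "\<psi> g"] by linarith
  qed
  then show "bdd_above ((\<lambda>f. norm (\<phi> f - \<psi> f)) ` {f \<in> Au p. Au_norm p f \<le> 1})"
    by (intro bdd_aboveI2) auto
qed

lemma spectrum_dist_self: "spectrum_dist p \<phi> \<phi> = 0"
proof -
  have "(\<lambda>x. 0) \<in> {f \<in> Au p. Au_norm p f \<le> 1}"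
    using Au_zero zero_in_lp_ball by (auto simp: Au_norm_def intro!: cSUP_least)
  then have "{f \<in> Au p. Au_norm p f \<le> 1} \<noteq> {}" by blast
  then show ?thesis by (simp add: spectrum_dist_def)
qed

lemma spectrum_dist_nonneg:
  assumes "1 \<le> p" "\<phi> \<in> Au_spectrum p" "\<psi> \<in> Au_spectrum p"
  shows "0 \<le> spectrum_dist p \<phi> \<psi>"
  by (rule order_trans[OF norm_ge_zero spectrum_dist_ge[OF assms Au_zero]]) simp

section \<open>Disc functions and the Gleason distance\<close>

lemma norm_one_plus_half_le:
  fixes w :: complex
  assumes "norm w \<le> 1" "\<eta> \<le> norm (w - 1)" "0 \<le> \<eta>"
  shows "(norm ((1 + w) / 2))\<^sup>2 \<le> 1 - \<eta>\<^sup>2 / 4"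
proof -
  \<comment> \<open>The parallelogram law for \<open>w\<close> and 1: the midpoint of 1 and a disc
    point away from 1 lies well inside the disc.\<close>
  have "(norm (w + 1))\<^sup>2 + (norm (w - 1))\<^sup>2 = 2 * (norm w)\<^sup>2 + 2"
    unfolding cmod_power2 by (simp add: power2_eq_square algebra_simps)
  moreover have "(norm w)\<^sup>2 \<le> 1" "\<eta>\<^sup>2 \<le> (norm (w - 1))\<^sup>2"
    using assms by (auto simp: power_le_one intro: power_mono)
  ultimately show ?thesis by (simp add: norm_divide power_divide add.commute)
qed

text \<open>The squared moduli of denominator and numerator differ by (1 - r^2)(1 - |k|^2). The
  product with \<open>inverse\<close> matches the way in which the function is assembled in the
  algebra.\<close>

lemma moebius_disc_le:
  fixes k :: complex
  assumes "0 \<le> r" "r < 1" "norm k \<le> 1"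
  shows "norm ((k - of_real r) * inverse (1 - of_real r * k)) \<le> 1"
proof -
  have "(norm (k - of_real r))\<^sup>2 + (1 - r\<^sup>2) * (1 - (norm k)\<^sup>2) = (norm (1 - of_real r * k))\<^sup>2"
    unfolding cmod_power2 by (simp add: power2_eq_square algebra_simps)
  moreover have "0 \<le> (1 - r\<^sup>2) * (1 - (norm k)\<^sup>2)"
    using assms by (intro mult_nonneg_nonneg) (auto simp: power_le_one abs_square_le_1)
  ultimately have "(norm (k - of_real r))\<^sup>2 \<le> (norm (1 - of_real r * k))\<^sup>2" by linarith
  then have "norm (k - of_real r) \<le> norm (1 - of_real r * k)" by (simp add: power2_le_iff_abs_le)
  then show ?thesis
    by (cases "1 - of_real r * k = 0") (simp_all add: divide_inverse[symmetric] norm_divide)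
qed

text \<open>
  The disc function \<open>w \<mapsto> M (((1 + w) / 2) ^ n)\<close>, with \<open>M\<close> the Moebius map fixing 1 and sending 0
  to \<open>- r\<close>, maps points near 1 and points away from 1 to distance almost \<open>1 + r\<close>, which exceeds the
  distance of the two characters.
\<close>

lemma gleason_part_peak:
  assumes p: "1 \<le> p" and \<phi>: "\<phi> \<in> Au_spectrum p" and \<psi>: "\<psi> \<in> Au_spectrum p"
    and d: "spectrum_dist p \<phi> \<psi> < 2" and \<eta>: "0 < \<eta>"
  obtains \<omega> where "0 < \<omega>" "\<And>f. f \<in> Au p \<Longrightarrow> (\<And>x. x \<in> lp_ball p \<Longrightarrow> norm (f x) \<le> 1) \<Longrightarrow>
    norm (\<phi> f - 1) < \<omega> \<Longrightarrow> norm (\<psi> f - 1) < \<eta>"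
proof -
  \<comment> \<open>Half of the distance is below 1, so the distance \<open>2 * r\<close> is less
    than \<open>1 + r\<close>, the separation of the images of 1 and 0 under the Moebius
    map.\<close>
  define r where "r = spectrum_dist p \<phi> \<psi> / 2"
  have r: "0 \<le> r" "r < 1" "spectrum_dist p \<phi> \<psi> < 1 + r"
    using d spectrum_dist_nonneg[OF p \<phi> \<psi>] by (auto simp: r_def)
  define M where "M k = (k - of_real r) * inverse (1 - of_real r * k)" for k :: complex
  have nz: "1 - complex_of_real r \<noteq> 0" using r by (metis of_real_1 of_real_eq_iff order_less_irrefl right_minus_eq)
  have "((\<lambda>t. norm (M (fst t) - M (snd t))) \<longlongrightarrow> norm (M 1 - M 0)) (at (1, 0))"
    unfolding M_def using nz by (auto intro!: tendsto_eq_intros)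
  moreover have "M 1 - M 0 = of_real (1 + r)" using nz by (simp add: M_def)
  then have "norm (M 1 - M 0) = 1 + r" using r by (simp only: norm_of_real)
  ultimately have "\<forall>\<^sub>F t in at (1, 0). spectrum_dist p \<phi> \<psi> < norm (M (fst t) - M (snd t))"
    using r(3) order_tendstoD(1) by metis
  then obtain e where e: "0 < e" "\<And>t. t \<noteq> (1, 0) \<Longrightarrow> dist t (1, 0) < e \<Longrightarrow> spectrum_dist p \<phi> \<psi> < norm (M (fst t) - M (snd t))"
    unfolding eventually_at by blast
  have sep: "spectrum_dist p \<phi> \<psi> < norm (M a - M b)" if "norm (a - 1) < e / 2" "norm b < e / 2" for a b
  proof (cases "(a, b) = (1, 0)")
    case True
    then show ?thesis using \<open>norm (M 1 - M 0) = 1 + r\<close> r by simp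
  next
    case False
    have "dist (a, b) (1, 0) \<le> dist a 1 + dist b 0"
      unfolding dist_Pair_Pair by (intro sqrt_sum_squares_le_sum) auto
    also have "\<dots> < e" using that by (simp add: dist_norm)
    finally show ?thesis using e(2)[OF False] by simp
  qed
  \<comment> \<open>Bounds the modulus of \<open>(1 + w) / 2\<close> for disc points
    \<open>w\<close> at distance at least \<eta> from 1; the maximum with 0 covers \<eta> above
    2.\<close>
  define q where "q = sqrt (max 0 (1 - \<eta>\<^sup>2 / 4))"
  have q: "0 \<le> q" "q < 1" using \<eta> by (auto simp: q_def)
  have "(\<lambda>n. q ^ n) \<longlonglongrightarrow> 0" using q by (intro LIMSEQ_power_zero) simp
  then obtain n where n: "q ^ n < e / 2"
    using e(1) order_tendstoD(2)[of "\<lambda>n. q ^ n" 0 sequentially "e / 2"]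
    by (metis eventually_happens' half_gt_zero sequentially_bot)
  \<comment> \<open>The exponent \<open>n\<close> is fixed by now, so the radius \<omega> that
    depends on it is the same for all f.\<close>
  have "((\<lambda>w :: complex. norm (((1 + w) / 2) ^ n - 1)) \<longlongrightarrow> 0) (at 1)"
    by (auto intro!: tendsto_eq_intros)
  then have "\<forall>\<^sub>F w in at 1. norm (((1 + w) / 2) ^ n - 1 :: complex) < e / 2"
    using e(1) by (intro order_tendstoD(2)) auto
  then obtain \<omega> where \<omega>: "0 < \<omega>" "\<And>w::complex. w \<noteq> 1 \<Longrightarrow> dist w 1 < \<omega> \<Longrightarrow> norm (((1 + w) / 2) ^ n - 1) < e / 2"
    unfolding eventually_at by blast
  show thesis
  proof (rule that[OF \<omega>(1)])
    fix f assume f: "f \<in> Au p" and f1: "\<And>x. x \<in> lp_ball p \<Longrightarrow> norm (f x) \<le> 1" and near: "norm (\<phi> f - 1) < \<omega>"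
    show "norm (\<psi> f - 1) < \<eta>"
    proof (rule ccontr)
      assume far: "\<not> norm (\<psi> f - 1) < \<eta>"
      \<comment> \<open>The disc function is built from affine maps, a power, an inverse and a
        product, because the value of a character is known to pass through these operations.\<close>
      let ?h = "\<lambda>x. if x \<in> lp_ball p then 1/2 * f x + 1/2 else 0"
      let ?k = "\<lambda>x. if x \<in> lp_ball p then ?h x ^ n else 0"
      let ?u = "\<lambda>x. if x \<in> lp_ball p then (- of_real r) * ?k x + 1 else 0"
      let ?v = "\<lambda>x. if x \<in> lp_ball p then 1 * ?k x + (- of_real r) else 0"
      let ?i = "\<lambda>x. if x \<in> lp_ball p then inverse (?u x) else 0"
      have h: "?h \<in> Au p" by (rule Au_affine[OF p f])
      have k: "?k \<in> Au p" by (rule Au_power[OF p h])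
      have u: "?u \<in> Au p" by (rule Au_affine[OF p k])
      have v: "?v \<in> Au p" by (rule Au_affine[OF p k])
      have k1: "norm (?k x) \<le> 1" for x
      proof -
        have "norm (?h x) \<le> 1" if "x \<in> lp_ball p"
          using f1[OF that] norm_triangle_ineq[of "f x / 2" "1 / 2"] that by (simp add: norm_divide)
        then show ?thesis by (auto simp: norm_power power_le_one)
      qed
      have u1: "1 - r \<le> norm (?u x)" if "x \<in> lp_ball p" for x
      proof -
        have "norm (of_real r * ?k x) \<le> r * 1"
          unfolding norm_mult using r k1 by (intro mult_mono) auto
        then show ?thesis using norm_triangle_ineq2[of 1 "of_real r * ?k x"] that by simp
      qed
      have r1: "0 < 1 - r" using r by simp
      have i: "?i \<in> Au p" by (rule Au_inverse[OF p u r1 u1])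
      have ev: "\<theta> (?v * ?i) = M (((1 + \<theta> f) / 2) ^ n)" if "\<theta> \<in> Au_spectrum p" for \<theta>
      proof -
        have kk: "\<theta> ?k = ((1 + \<theta> f) / 2) ^ n"
          unfolding spectrum_power[OF p that h] spectrum_affine[OF p that f] by (simp add: add_divide_distrib add.commute)
        have "\<theta> ?i = inverse (\<theta> ?u)" by (rule spectrum_inverse(2)[OF p that u r1 u1])
        moreover have "\<theta> ?u = (- of_real r) * \<theta> ?k + 1" by (rule spectrum_affine[OF p that k])
        moreover have "\<theta> ?v = 1 * \<theta> ?k + (- of_real r)" by (rule spectrum_affine[OF p that k])
        ultimately show ?thesis
          unfolding spectrum_mult[OF that v i] kk M_def by simp
      qed
      have vi1: "norm ((?v * ?i) x) \<le> 1" if x: "x \<in> lp_ball p" for x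
        using moebius_disc_le[OF r(1,2) k1[of x]] x by simp
      have "norm (M (((1 + \<phi> f) / 2) ^ n) - M (((1 + \<psi> f) / 2) ^ n)) \<le> spectrum_dist p \<phi> \<psi>"
        unfolding ev[OF \<phi>, symmetric] ev[OF \<psi>, symmetric]
        by (rule spectrum_dist_ge[OF p \<phi> \<psi> Au_mult[OF p v i] vi1])
      moreover have "norm (((1 + \<phi> f) / 2) ^ n - 1) < e / 2"
        using \<omega>(2)[of "\<phi> f"] near e(1) by (cases "\<phi> f = 1") (auto simp: dist_norm)
      moreover have "norm (((1 + \<psi> f) / 2) ^ n) < e / 2"
      proof -
        have "norm (\<psi> f) \<le> 1" by (rule spectrum_contractive[OF p \<psi> f f1])
        then have "(norm ((1 + \<psi> f) / 2))\<^sup>2 \<le> q\<^sup>2"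
          using norm_one_plus_half_le[of "\<psi> f" \<eta>] far \<eta> by (simp add: q_def)
        then have "norm ((1 + \<psi> f) / 2) \<le> q" using q by (simp add: power2_le_iff_abs_le)
        then have "norm ((1 + \<psi> f) / 2) ^ n \<le> q ^ n" by (intro power_mono) auto
        then show ?thesis using n by (simp only: norm_power)
      qed
      ultimately show False using sep by fastforce
    qed
  qed
qed

section \<open>Evaluations and the weak-star topology\<close>

lemma eval_hom_apply: "1 \<le> p \<Longrightarrow> f \<in> Au p \<Longrightarrow> x \<in> lp_ball p \<Longrightarrow> eval_hom p x f = f x"
  by (simp add: eval_hom_def Au_extension_ball)

lemma eval_hom_in_spectrum:
  assumes "1 \<le> p" "x \<in> lp_ball p" shows "eval_hom p x \<in> Au_spectrum p"
proof -
  note ev = eval_hom_apply[OF assms(1) _ assms(2)]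
  have "eval_hom p x \<in> extensional (Au p)" by (simp add: eval_hom_def)
  moreover have "eval_hom p x (\<lambda>x. if x \<in> lp_ball p then 1 else 0) \<noteq> 0"
    using ev[OF Au_const] assms(2) by simp
  ultimately show ?thesis
    unfolding Au_spectrum_def using Au_const[of p 1]
    by (auto simp: ev Au_add Au_scale[OF assms(1)] Au_mult[OF assms(1)] intro!: bexI[of _ "\<lambda>x. if x \<in> lp_ball p then 1 else 0"])
qed

lemma topspace_spectrum: "topspace (spectrum_topology p) = Au_spectrum p"
  by (auto simp: spectrum_topology_def PiE_def Au_spectrum_def)

lemma openin_spectrum_nbhd:
  assumes "finite S" "S \<subseteq> Au p"
  shows "openin (spectrum_topology p) {\<theta> \<in> Au_spectrum p. \<forall>f\<in>S. dist (\<theta> f) (\<psi> f) < e f}"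
proof -
  have "openin (spectrum_topology p) {\<theta> \<in> topspace (spectrum_topology p). \<theta> f \<in> ball (\<psi> f) (e f)}" if "f \<in> S" for f
  proof (rule openin_continuous_map_preimage)
    show "continuous_map (spectrum_topology p) euclidean (\<lambda>\<theta>. \<theta> f)"
      unfolding spectrum_topology_def using that assms
      by (intro continuous_map_from_subtopology continuous_map_product_projection) auto
  qed auto
  then have "openin (spectrum_topology p) (topspace (spectrum_topology p) \<inter>
      (\<Inter>f\<in>S. {\<theta> \<in> topspace (spectrum_topology p). \<theta> f \<in> ball (\<psi> f) (e f)}))"
    using assms(1) by (cases "S = {}") (auto intro!: openin_Int openin_INT)
  moreover have "(topspace (spectrum_topology p) \<inter>
      (\<Inter>f\<in>S. {\<theta> \<in> topspace (spectrum_topology p). \<theta> f \<in> ball (\<psi> f) (e f)})) =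
      {\<theta> \<in> Au_spectrum p. \<forall>f\<in>S. dist (\<theta> f) (\<psi> f) < e f}"
    by (auto simp: topspace_spectrum dist_commute)
  ultimately show ?thesis by simp
qed

text \<open>Weak-star convergence is checked on each f separately, where it is the radial limit of
  f. That the limit is a character is a hypothesis, which the later use reads off from an open set
  of the spectrum containing it.\<close>

lemma limitin_eval_hom_radial:
  assumes "1 \<le> p" "x \<in> lp_space p" "lp_norm p x \<le> 1" "eval_hom p x \<in> Au_spectrum p"
  shows "limitin (spectrum_topology p) (\<lambda>r. eval_hom p (\<lambda>i. of_real r * x i)) (eval_hom p x) (at_left (1::real))"
proof -
  have b: "\<forall>\<^sub>F r in at_left (1::real). (\<lambda>i. of_real r * x i) \<in> lp_ball p"
    using assms by (intro eventually_at_leftI[of 0]) (auto intro!: lp_ball_scale)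
  have "limitin euclidean (\<lambda>r. eval_hom p (\<lambda>i. of_real r * x i) f) (eval_hom p x f) (at_left (1::real))"
    if f: "f \<in> Au p" for f
  proof -
    have "\<forall>\<^sub>F r in at_left (1::real). f (\<lambda>i. of_real r * x i) = eval_hom p (\<lambda>i. of_real r * x i) f"
      using b by eventually_elim (simp add: eval_hom_apply[OF assms(1) f])
    then have "((\<lambda>r. eval_hom p (\<lambda>i. of_real r * x i) f) \<longlongrightarrow> Au_extension p f x) (at_left 1)"
      by (rule Lim_transform_eventually[OF Au_radial_limit[OF assms(1) f assms(2,3)]])
    then show ?thesis using f by (simp add: eval_hom_def)
  qed
  moreover have "\<forall>\<^sub>F r in at_left (1::real). eval_hom p (\<lambda>i. of_real r * x i) \<in> Au_spectrum p"
    using b by eventually_elim (rule eval_hom_in_spectrum[OF assms(1)])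
  ultimately show ?thesis
    unfolding spectrum_topology_def limitin_subtopology limitin_componentwise using assms(4)
    by (auto simp: eval_hom_def)
qed

text \<open>A basic weak-star neighbourhood tests finitely many functions, so one point of the ball
  imitates \<psi> on all of them at once. It is applied to \<open>g\<close> together with two peak
  functions.\<close>

lemma ball_closureD:
  assumes "\<psi> \<in> ball_closure p" "1 \<le> p" "finite S" "S \<subseteq> Au p" "0 < e"
  obtains y where "y \<in> lp_ball p" "\<And>f. f \<in> S \<Longrightarrow> dist (f y) (\<psi> f) < e"
proof -
  let ?N = "{\<theta> \<in> Au_spectrum p. \<forall>f\<in>S. dist (\<theta> f) (\<psi> f) < e}"
  have cl: "\<psi> \<in> spectrum_topology p closure_of (eval_hom p ` lp_ball p)"
    using assms(1) by (simp only: ball_closure_def)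
  then have "\<psi> \<in> Au_spectrum p"
    using subsetD[OF closure_of_subset_topspace cl] by (simp only: topspace_spectrum)
  then have "\<psi> \<in> ?N" using assms(5) by simp
  then have "\<exists>\<theta>. \<theta> \<in> eval_hom p ` lp_ball p \<and> \<theta> \<in> ?N"
    using cl[unfolded in_closure_of, THEN conjunct2, THEN spec[of _ ?N]]
      openin_spectrum_nbhd[OF assms(3,4), of \<psi> "\<lambda>_. e"] by (simp only: simp_thms)
  then obtain y where y: "y \<in> lp_ball p" "\<forall>f\<in>S. dist (eval_hom p y f) (\<psi> f) < e"
    by auto
  have "dist (f y) (\<psi> f) < e" if "f \<in> S" for f
    using bspec[OF y(2) that] eval_hom_apply[OF assms(2) subsetD[OF assms(4) that] y(1)] by simp
  with y(1) show thesis by (rule that)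
qed

text \<open>The conclusion keeps \<open>frequently\<close> instead of mere existence, because the
  index must later be taken beyond \<open>m\<close>.\<close>

lemma cluster_pointD:
  assumes "\<phi> \<in> cluster_points (spectrum_topology p) \<sigma>" "finite S" "S \<subseteq> Au p" "0 < e"
  shows "\<exists>\<^sub>F n in sequentially. \<forall>f\<in>S. dist (\<sigma> n f) (\<phi> f) < e"
proof -
  let ?N = "{\<theta> \<in> Au_spectrum p. \<forall>f\<in>S. dist (\<theta> f) (\<phi> f) < e}"
  have \<phi>: "\<phi> \<in> Au_spectrum p"
    and cl: "\<And>U. openin (spectrum_topology p) U \<and> \<phi> \<in> U \<longrightarrow> (\<exists>\<^sub>F n in sequentially. \<sigma> n \<in> U)"
    using assms(1) by (simp_all add: cluster_points_def topspace_spectrum)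
  from \<phi> have "\<phi> \<in> ?N" using assms(4) by simp
  then have "\<exists>\<^sub>F n in sequentially. \<sigma> n \<in> ?N"
    using cl[of ?N] openin_spectrum_nbhd[OF assms(2,3), of \<phi> "\<lambda>_. e"] by (simp only: simp_thms)
  then show ?thesis by (rule frequently_elim1) auto
qed

text \<open>The points may have norm 1 and so lie outside the open ball. An open set containing
  \<phi> contains some evaluation at \<open>x n\<close>, hence also evaluations at slightly shrunken
  copies of that point.\<close>

lemma cluster_point_in_ball_closure:
  assumes "1 \<le> p" "\<And>n. x n \<in> lp_space p" "\<And>n. lp_norm p (x n) \<le> 1"
    "\<phi> \<in> cluster_points (spectrum_topology p) (\<lambda>n. eval_hom p (x n))"
  shows "\<phi> \<in> ball_closure p"
  unfolding ball_closure_def in_closure_of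
proof (intro conjI allI impI)
  show "\<phi> \<in> topspace (spectrum_topology p)" using assms(4) by (simp add: cluster_points_def)
  fix U assume U: "\<phi> \<in> U \<and> openin (spectrum_topology p) U"
  then have "\<exists>\<^sub>F n in sequentially. eval_hom p (x n) \<in> U" using assms(4) by (simp add: cluster_points_def)
  then obtain n where n: "eval_hom p (x n) \<in> U" using frequently_ex by blast
  then have "eval_hom p (x n) \<in> Au_spectrum p" using U openin_subset topspace_spectrum by blast
  then have "limitin (spectrum_topology p) (\<lambda>r. eval_hom p (\<lambda>i. of_real r * x n i)) (eval_hom p (x n)) (at_left (1::real))"
    using assms by (intro limitin_eval_hom_radial) auto
  then have "\<forall>\<^sub>F r in at_left (1::real). eval_hom p (\<lambda>i. of_real r * x n i) \<in> U"
    using U n unfolding limitin_def by blast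
  moreover have "\<forall>\<^sub>F r in at_left (1::real). (\<lambda>i. of_real r * x n i) \<in> lp_ball p"
    using assms by (intro eventually_at_leftI[of 0]) (auto intro!: lp_ball_scale)
  ultimately have "\<forall>\<^sub>F r in at_left (1::real). eval_hom p (\<lambda>i. of_real r * x n i) \<in> U \<and> (\<lambda>i. of_real r * x n i) \<in> lp_ball p"
    by eventually_elim simp
  then obtain r where "eval_hom p (\<lambda>i. of_real r * x n i) \<in> U" "(\<lambda>i. of_real r * x n i) \<in> lp_ball p"
    using eventually_happens'[OF trivial_limit_at_left_real] by blast
  then show "\<exists>y. y \<in> eval_hom p ` lp_ball p \<and> y \<in> U" by blast
qed

section \<open>The equality case of Young's inequality\<close>

text \<open>The mean value theorem produces the slope \<open>p * c powr (p - 1)\<close> with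
  \<open>c\<close> between 1 and r: more than p to the right of 1, less than p to the left. The
  point 0 stands apart since the derivative is used at positive arguments. Strictness will give the
  equality case of Young's inequality.\<close>

lemma bernoulli_powr_strict:
  fixes r :: real
  assumes "1 < p" "0 \<le> r" "r \<noteq> 1"
  shows "1 + p * (r - 1) < r powr p"
proof (cases "r = 0")
  case True
  then show ?thesis using assms by simp
next
  case False
  then have r: "0 < r" using assms by simp
  have d: "((\<lambda>x. x powr p) has_real_derivative p * x powr (p - 1)) (at x)" if "0 < x" for x
    using that by (auto intro!: derivative_eq_intros)
  show ?thesis
  proof (cases "1 < r")
    case True
    obtain c where c: "1 < c" "c < r" "r powr p - 1 powr p = (r - 1) * (p * c powr (p - 1))"
      using MVT2[OF True, of "\<lambda>x. x powr p" "\<lambda>x. p * x powr (p - 1)"] d by auto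
    have "1 < c powr (p - 1)" using c assms by (simp add: gr_one_powr)
    then have "(r - 1) * (p * 1) < (r - 1) * (p * c powr (p - 1))"
      using True assms by (intro mult_strict_left_mono) auto
    then show ?thesis using c by (simp add: algebra_simps)
  next
    case False
    then have r1: "r < 1" using assms by simp
    obtain c where c: "r < c" "c < 1" "1 powr p - r powr p = (1 - r) * (p * c powr (p - 1))"
      using MVT2[OF r1, of "\<lambda>x. x powr p" "\<lambda>x. p * x powr (p - 1)"] d r by auto
    have "c powr (p - 1) < 1 powr (p - 1)" using c r assms by (intro powr_less_mono2) auto
    then have "(1 - r) * (p * c powr (p - 1)) < (1 - r) * (p * 1)"
      using r1 assms by (intro mult_strict_left_mono) auto
    then show ?thesis using c by (simp add: algebra_simps)
  qed
qed

text \<open>One coordinate of the duality map of the sequence space, the gradient of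
  \<open>norm w powr p / p\<close> up to conjugation: its modulus is
  \<open>norm w powr (p - 1)\<close> and its product with \<open>w\<close> is
  \<open>norm w powr p\<close>. At 0 the factor \<open>cnj w\<close> makes it 0.\<close>

definition young_dual :: "real \<Rightarrow> complex \<Rightarrow> complex" where
  "young_dual p w = of_real (norm w powr (p - 2)) * cnj w"

text \<open>The deficit in Young's inequality for the product of \<open>young_dual p w\<close> and
  \<open>u\<close>. Taking the real part instead of the modulus makes it sensitive to phases, so
  that for p > 1 it vanishes only at \<open>u = w\<close>.\<close>

definition young_gap :: "real \<Rightarrow> complex \<Rightarrow> complex \<Rightarrow> real" where
  "young_gap p w u = (1 - 1 / p) * norm w powr p + norm u powr p / p - Re (young_dual p w * u)"

lemma norm_young_dual: "norm (young_dual p w) = norm w powr (p - 1)"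
proof (cases "w = 0")
  case False
  have "norm w * norm w powr (p - 2) = norm w powr (p - 1)"
    using powr_mult_base[of "norm w" "p - 2"] by simp
  then show ?thesis by (simp add: young_dual_def norm_mult mult.commute)
qed (simp add: young_dual_def)

lemma young_dual_mult:
  assumes "w \<noteq> 0" shows "young_dual p w * u = of_real (norm w powr p) * (u / w)"
proof -
  have "norm w powr p = norm w powr (p - 2) * norm w powr 2" by (simp only: powr_add[symmetric]) simp
  also have "norm w powr 2 = (norm w)\<^sup>2" using assms by (simp add: powr_numeral)
  finally have "of_real (norm w powr p) = of_real (norm w powr (p - 2)) * (w * cnj w)"
    using complex_norm_square[of w] by (simp only: of_real_mult)
  then show ?thesis using assms by (simp add: young_dual_def)
qed

lemma young_dual_self: "0 < p \<Longrightarrow> young_dual p w * w = of_real (norm w powr p)"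
  using young_dual_mult[of w p w] by (cases "w = 0") (simp_all add: young_dual_def[of p 0])

lemma young_dual_one: "young_dual p 1 = 1"
  by (simp add: young_dual_def)

lemma young_gap_one_ge: "norm v powr p / p - norm v \<le> young_gap p 1 v" if "1 < p"
proof -
  have "1 / p \<le> 1" using that by simp
  then show ?thesis
    using complex_Re_le_cmod[of v] unfolding young_gap_def young_dual_one by simp
qed

text \<open>A wrong modulus is detected by the strict Bernoulli inequality, a wrong phase at modulus
  1 by the real part.\<close>

lemma young_gap_one_pos:
  assumes "1 < p" "v \<noteq> 1" shows "0 < young_gap p 1 v"
proof (cases "norm v = 1")
  case True
  have "Re v \<noteq> 1"
  proof
    assume "Re v = 1"
    then have "(Im v)\<^sup>2 = 0" using True cmod_power2[of v] by simp
    then show False using \<open>Re v = 1\<close> assms(2) by (simp add: complex_eq_iff)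
  qed
  then have "Re v < 1" using complex_Re_le_cmod[of v] True by simp
  then show ?thesis using True by (simp add: young_gap_def young_dual_def)
next
  case False
  have "0 < (norm v powr p - (1 + p * (norm v - 1))) / p"
    using bernoulli_powr_strict[OF assms(1) norm_ge_zero False] assms by simp
  also have "\<dots> = 1 - 1 / p + norm v powr p / p - norm v" using assms by (simp add: field_simps)
  also have "\<dots> \<le> young_gap p 1 v"
    using complex_Re_le_cmod[of v] by (simp add: young_gap_def young_dual_def)
  finally show ?thesis .
qed

text \<open>Homogeneity of degree p leaves \<open>u / w\<close> as the only variable, which makes a
  compactness argument in the plane possible.\<close>

lemma young_gap_scale:
  assumes "w \<noteq> 0" shows "young_gap p w u = norm w powr p * young_gap p 1 (u / w)"
proof -
  have "Re (young_dual p w * u) = norm w powr p * Re (u / w)"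
    unfolding young_dual_mult[OF assms]
    by (simp only: times_complex.sel Re_complex_of_real Im_complex_of_real)
  moreover have "norm u powr p = norm w powr p * norm (u / w) powr p"
    using assms by (simp add: norm_divide powr_divide)
  ultimately show ?thesis
    unfolding young_gap_def young_dual_one by (simp add: algebra_simps)
qed

lemma young_gap_nonneg:
  assumes "1 < p" shows "0 \<le> young_gap p w u"
proof (cases "w = 0")
  case True
  then show ?thesis using assms by (simp add: young_gap_def young_dual_def)
next
  case False
  have "0 \<le> young_gap p 1 (u / w)"
  proof (cases "u / w = 1")
    case True
    then show ?thesis using assms by (simp add: young_gap_def young_dual_def)
  qed (use young_gap_one_pos[OF assms] in \<open>auto intro: less_imp_le\<close>)
  then show ?thesis unfolding young_gap_scale[OF False] by simp
qed

text \<open>For large v the gap is comparable to \<open>norm v powr p\<close>; on a compact set away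
  from 1 it has a positive minimum; near 1 the left side is below \<eta>. The \<eta> term pays for
  that last region, where the gap is only quadratic in \<open>v - 1\<close> while the left side
  contains a linear term.\<close>

lemma young_gap_one_controls:
  assumes p: "1 < p" and \<eta>: "0 < \<eta>"
  obtains C where "0 \<le> C" "\<And>v. norm (v - 1) powr p + norm (v - 1) \<le> \<eta> * (1 + norm v powr p) + C * young_gap p 1 v"
proof -
  let ?D = "\<lambda>v :: complex. norm (v - 1) powr p + norm (v - 1)"
  \<comment> \<open>From here on \<open>norm v powr (p - 1)\<close> is at least
    \<open>2 * p\<close>, so subtracting \<open>norm v\<close> costs at most half of
    \<open>norm v powr p / p\<close>.\<close>
  define R where "R = max 1 ((2 * p) powr (1 / (p - 1)))"
  define C1 where "C1 = 2 * p * (2 powr p + 2)"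
  have large: "?D v \<le> C1 * young_gap p 1 v" if "R \<le> norm v" for v
  proof -
    have v1: "1 \<le> norm v" using that by (simp add: R_def)
    have "2 * p = ((2 * p) powr (1 / (p - 1))) powr (p - 1)" using p by (simp add: powr_powr)
    also have "\<dots> \<le> norm v powr (p - 1)" using that p by (intro powr_mono2) (auto simp: R_def)
    finally have "norm v * (2 * p) \<le> norm v * norm v powr (p - 1)" by (intro mult_left_mono) auto
    also have "\<dots> = norm v powr p" by (simp add: powr_mult_base)
    finally have "norm v \<le> norm v powr p / (2 * p)" using p by (simp add: field_simps)
    moreover have "norm v powr p / p - norm v powr p / (2 * p) = norm v powr p / (2 * p)"
      using p by (simp add: field_simps)
    ultimately have g: "norm v powr p / (2 * p) \<le> young_gap p 1 v"
      using young_gap_one_ge[OF p, of v] by linarith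
    have t: "norm (v - 1) \<le> 2 * norm v" using norm_triangle_ineq4[of v 1] v1 by simp
    then have "norm (v - 1) powr p \<le> (2 * norm v) powr p" using p by (intro powr_mono2) auto
    then have "norm (v - 1) powr p \<le> 2 powr p * norm v powr p" by (simp add: powr_mult)
    moreover have "norm v \<le> norm v powr p" using powr_mono[of 1 p "norm v"] p v1 by simp
    ultimately have "?D v \<le> (2 powr p + 2) * norm v powr p" using t by (simp add: distrib_right)
    also have "\<dots> = C1 * (norm v powr p / (2 * p))" using p by (simp add: C1_def)
    also have "\<dots> \<le> C1 * young_gap p 1 v" using g p by (intro mult_left_mono) (auto simp: C1_def)
    finally show ?thesis .
  qed
  \<comment> \<open>The lower bound \<eta> keeps 1, the only zero of the gap, out of this compact
    set.\<close>
  define K where "K = cball 0 R \<inter> {v :: complex. \<eta> \<le> ?D v}"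
  have "continuous_on UNIV ?D" using p by (intro continuous_intros continuous_on_powr') auto
  then have "compact K" unfolding K_def
    by (intro compact_Int_closed closed_Collect_le) (auto intro: continuous_on_const)
  have cg: "continuous_on K (young_gap p 1)"
    unfolding young_gap_def young_dual_def using p by (intro continuous_intros continuous_on_powr') auto
  obtain C2 where C2: "0 \<le> C2" "\<And>v. v \<in> K \<Longrightarrow> ?D v \<le> C2 * young_gap p 1 v"
  proof (cases "K = {}")
    case True
    then show thesis using that[of 0] by auto
  next
    case False
    obtain v0 where v0: "v0 \<in> K" "\<And>v. v \<in> K \<Longrightarrow> young_gap p 1 v0 \<le> young_gap p 1 v"
      using continuous_attains_inf[OF \<open>compact K\<close> False cg] by blast
    have "v0 \<noteq> 1" using v0(1) \<eta> by (auto simp: K_def)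
    then have c: "0 < young_gap p 1 v0" by (rule young_gap_one_pos[OF p])
    have R1: "1 \<le> R" by (simp add: R_def)
    define c2 where "c2 = ((R + 1) powr p + (R + 1)) / young_gap p 1 v0"
    have c2: "0 \<le> c2" using c R1 by (auto simp: c2_def)
    have "?D v \<le> c2 * young_gap p 1 v" if "v \<in> K" for v
    proof -
      have n: "norm (v - 1) \<le> R + 1" using that norm_triangle_ineq4[of v 1] by (simp add: K_def)
      then have "norm (v - 1) powr p \<le> (R + 1) powr p" using p by (intro powr_mono2) auto
      then have "?D v \<le> c2 * young_gap p 1 v0" using n c by (simp add: c2_def)
      also have "\<dots> \<le> c2 * young_gap p 1 v" using v0(2)[OF that] c2 by (rule mult_left_mono)
      finally show ?thesis .
    qed
    then show thesis using that[of c2] c2 by blast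
  qed
  have C1: "0 \<le> C1" using p by (simp add: C1_def)
  show thesis
  proof (rule that)
    show "0 \<le> C1 + C2" using C1 C2 by simp
    fix v :: complex
    note g = young_gap_nonneg[OF p, of 1 v]
    have m: "0 \<le> C1 * young_gap p 1 v" "0 \<le> C2 * young_gap p 1 v" "0 \<le> \<eta> * norm v powr p"
      using g C1 C2 \<eta> by auto
    consider "R \<le> norm v" | "v \<in> K" | "?D v \<le> \<eta>" 
      by (cases "R \<le> norm v"; cases "\<eta> \<le> ?D v") (auto simp: K_def)
    then have "?D v \<le> \<eta> + (C1 * young_gap p 1 v + C2 * young_gap p 1 v)"
    proof cases
      case 1
      then show ?thesis using large[OF 1] m \<eta> by linarith
    next
      case 2
      then show ?thesis using C2(2)[OF 2] m \<eta> by linarith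
    next
      case 3
      then show ?thesis using m by linarith
    qed
    then show "?D v \<le> \<eta> * (1 + norm v powr p) + (C1 + C2) * young_gap p 1 v"
      using m by (simp add: distrib_left distrib_right)
  qed
qed

text \<open>This replaces uniform convexity: being scalar and additive, it can be summed over the coordinates.\<close>

lemma young_gap_controls:
  assumes p: "1 < p" and \<eta>: "0 < \<eta>"
  obtains C where "0 \<le> C" "\<And>w u. norm (u - w) powr p + norm w powr (p - 1) * norm (u - w) \<le>
    \<eta> * (norm w powr p + norm u powr p) + C * young_gap p w u"
proof -
  obtain C where C: "0 \<le> C"
    "\<And>v. norm (v - 1) powr p + norm (v - 1) \<le> \<eta> * (1 + norm v powr p) + C * young_gap p 1 v"
    using young_gap_one_controls[OF assms] by blast
  show thesis
  proof (rule that[of "C + p"])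
    show "0 \<le> C + p" using C p by simp
    fix w u :: complex
    show "norm (u - w) powr p + norm w powr (p - 1) * norm (u - w) \<le>
      \<eta> * (norm w powr p + norm u powr p) + (C + p) * young_gap p w u"
    proof (cases "w = 0")
      case True
      have "young_gap p w u = norm u powr p / p" using True by (simp add: young_gap_def young_dual_def)
      moreover have "p * (norm u powr p / p) \<le> (C + p) * (norm u powr p / p)"
        using C p by (intro mult_right_mono) auto
      moreover have "0 \<le> \<eta> * norm u powr p" using \<eta> by simp
      ultimately show ?thesis using True p by simp
    next
      case False
      let ?v = "u / w"
      have n: "norm (u - w) = norm w * norm (?v - 1)"
        using False by (simp flip: norm_mult add: algebra_simps)
      have w: "norm w powr (p - 1) * norm w = norm w powr p"
        using powr_mult_base[of "norm w" "p - 1"] by (simp add: mult.commute)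
      have "norm (u - w) powr p + norm w powr (p - 1) * norm (u - w) =
          norm w powr p * (norm (?v - 1) powr p + norm (?v - 1))"
        unfolding n by (simp add: powr_mult distrib_left w mult.assoc[symmetric])
      also have "\<dots> \<le> norm w powr p * (\<eta> * (1 + norm ?v powr p) + C * young_gap p 1 ?v)"
        by (intro mult_left_mono C) auto
      also have "\<dots> = \<eta> * (norm w powr p + norm u powr p) + C * young_gap p w u"
        using False by (simp add: young_gap_scale[OF False] norm_divide powr_divide algebra_simps)
      also have "\<dots> \<le> \<eta> * (norm w powr p + norm u powr p) + (C + p) * young_gap p w u"
        using young_gap_nonneg[OF p, of w u] p by (simp add: distrib_right)
      finally show ?thesis .
    qed
  qed
qed

text \<open>On the part of \<open>K\<close> outside a neighbourhood of \<open>x0\<close> the maximum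
  of h stays strictly below \<open>h x0\<close>, which eventually excludes \<open>X n\<close> from
  that part.\<close>

lemma tendsto_unique_maximizer:
  fixes h :: "'a::metric_space \<Rightarrow> real"
  assumes "compact K" "continuous_on K h" "\<And>x. x \<in> K \<Longrightarrow> x \<noteq> x0 \<Longrightarrow> h x < h x0"
    and "\<And>n. X n \<in> K" "(\<lambda>n. h (X n)) \<longlonglongrightarrow> h x0"
  shows "X \<longlonglongrightarrow> x0"
proof (rule topological_tendstoI)
  fix S assume S: "open S" "x0 \<in> S"
  show "\<forall>\<^sub>F n in sequentially. X n \<in> S"
  proof (cases "K - S = {}")
    case True
    then show ?thesis using assms(4) by (auto intro!: always_eventually)
  next
    case False
    obtain y where y: "y \<in> K - S" "\<And>x. x \<in> K - S \<Longrightarrow> h x \<le> h y"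
      using continuous_attains_sup[OF compact_diff[OF assms(1) S(1)] False]
        continuous_on_subset[OF assms(2)] by (metis Diff_subset)
    have "h y < h x0" using y(1) S assms(3) by auto
    then have "\<forall>\<^sub>F n in sequentially. h y < h (X n)" using assms(5) order_tendstoD(1) by metis
    then show ?thesis
    proof eventually_elim
      case (elim n)
      then show ?case using y(2)[of "X n"] assms(4)[of n] by force
    qed
  qed
qed

text \<open>Both rest on the tangent line inequality \<open>b \<le> exp (b - 1)\<close>, strict away
  from 1.\<close>

lemma mult_exp_le_1: "b * exp (1 - b) \<le> (1 :: real)"
  and mult_exp_less_1: "b \<noteq> 1 \<Longrightarrow> b * exp (1 - b) < (1 :: real)"
proof -
  have e: "exp (1 - b) = inverse (exp (b - 1))" by (simp flip: exp_minus)
  show "b * exp (1 - b) \<le> 1"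
    using exp_ge_add_one_self[of "b - 1"] by (simp add: e field_simps)
  assume "b \<noteq> 1"
  have "b < exp (b - 1)"
  proof (cases "0 < b")
    case True
    then have "ln b < b - 1" using ln_le_minus_one[of b] ln_eq_minus_one[of b] \<open>b \<noteq> 1\<close> by fastforce
    then show ?thesis using True by (metis exp_less_cancel_iff exp_ln)
  qed (use exp_gt_zero[of "b - 1"] in linarith)
  then show "b * exp (1 - b) < 1" by (simp add: e field_simps)
qed

section \<open>Almost peaking functions\<close>

text \<open>Cut off by a condition instead of an index shift, so that it can be compared termwise
  with other series in the original indices.\<close>

definition lp_tail :: "real \<Rightarrow> nat \<Rightarrow> (nat \<Rightarrow> complex) \<Rightarrow> real" where
  "lp_tail p m y = (\<Sum>i. if m \<le> i then norm (y i) powr p else 0)"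

lemma lp_tail_sums:
  assumes "y \<in> lp_space p"
  shows "(\<lambda>i. if m \<le> i then norm (y i) powr p else 0) sums lp_tail p m y"
    and "(\<Sum>i. norm (y i) powr p) = (\<Sum>i<m. norm (y i) powr p) + lp_tail p m y"
proof -
  have s: "summable (\<lambda>i. if m \<le> i then norm (y i) powr p else 0)"
    by (rule summable_comparison_test'[OF lp_summable[OF assms]]) auto
  then show 1: "(\<lambda>i. if m \<le> i then norm (y i) powr p else 0) sums lp_tail p m y"
    unfolding lp_tail_def by (rule summable_sums)
  have "(\<lambda>i. if i \<in> {..<m} then norm (y i) powr p else 0) sums (\<Sum>i<m. norm (y i) powr p)"
    by (rule sums_If_finite_set) simp
  from sums_add[OF this 1]
  have "(\<lambda>i. (if i \<in> {..<m} then norm (y i) powr p else 0) + (if m \<le> i then norm (y i) powr p else 0))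
      sums ((\<Sum>i<m. norm (y i) powr p) + lp_tail p m y)" .
  moreover have "(\<lambda>i. (if i \<in> {..<m} then norm (y i) powr p else 0) + (if m \<le> i then norm (y i) powr p else 0)) =
      (\<lambda>i. norm (y i) powr p)" by (rule ext) auto
  ultimately have "(\<lambda>i. norm (y i) powr p) sums ((\<Sum>i<m. norm (y i) powr p) + lp_tail p m y)"
    by (simp only:)
  then show "(\<Sum>i. norm (y i) powr p) = (\<Sum>i<m. norm (y i) powr p) + lp_tail p m y"
    by (rule sums_unique[symmetric])
qed

lemma lp_tail_nonneg: "y \<in> lp_space p \<Longrightarrow> 0 \<le> lp_tail p m y"
  by (rule sums_le[OF _ sums_zero lp_tail_sums(1)]) simp_all

lemma lp_tail_tendsto_0:
  assumes "z \<in> lp_space p" shows "(\<lambda>m. lp_tail p m z) \<longlonglongrightarrow> 0"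
proof -
  have "(\<lambda>m. (\<Sum>i. norm (z i) powr p) - (\<Sum>i<m. norm (z i) powr p)) \<longlonglongrightarrow>
      (\<Sum>i. norm (z i) powr p) - (\<Sum>i. norm (z i) powr p)"
    by (intro tendsto_intros summable_LIMSEQ lp_summable assms)
  moreover have "lp_tail p m z = (\<Sum>i. norm (z i) powr p) - (\<Sum>i<m. norm (z i) powr p)" for m
    using lp_tail_sums(2)[OF assms, of m] by simp
  ultimately show ?thesis by simp
qed

lemma coord_le_lp_tail:
  assumes "y \<in> lp_space p" "m \<le> j" shows "norm (y j) powr p \<le> lp_tail p m y"
proof (rule sums_le[OF _ sums_single lp_tail_sums(1)[OF assms(1)]])
  show "(if i = j then norm (y i) powr p else 0) \<le> (if m \<le> i then norm (y i) powr p else 0)" for i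
    using assms(2) by auto
qed

text \<open>Subtracting \<open>t\<close> alone would give 0 when the head of y is that of z, but a
  head with more mass than \<open>t\<close> could make the real part too large. The correction
  \<open>(1 - s powr p - t) / p\<close> pays for this surplus. For the intended s it is the tail
  mass of z divided by p, so it disappears as m grows.\<close>

definition peak_base :: "real \<Rightarrow> real \<Rightarrow> (nat \<Rightarrow> complex) \<Rightarrow> nat \<Rightarrow> (nat \<Rightarrow> complex) \<Rightarrow> complex" where
  "peak_base p s z m y = (let t = \<Sum>i<m. norm (z i) powr p in
     ((\<Sum>i<m. young_dual p (z i) * y i) - of_real (t + (1 - s powr p - t) / p)) / of_real (s powr p))"

text \<open>The power sum starts at \<open>m\<close>, where the exponential stops: the factors see
  disjoint sets of coordinates, whose masses add up to at most 1.\<close>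

definition peak_fun :: "real \<Rightarrow> real \<Rightarrow> (nat \<Rightarrow> complex) \<Rightarrow> nat set \<Rightarrow> nat \<Rightarrow> nat \<Rightarrow> (nat \<Rightarrow> complex) \<Rightarrow> complex" where
  "peak_fun p s z A n m y = exp (of_nat n * peak_base p s z m y) *
     (\<Sum>j. if j \<in> A \<inter> {m..} then y j ^ n else 0) / of_real (s ^ n)"

text \<open>Young's inequality summed over the head bounds the functional by the masses of the heads
  minus the gaps; the mass 1 available to y converts the head of y into its tail.\<close>

lemma Re_peak_base_le:
  assumes p: "1 < p" and s: "0 < s" and y: "y \<in> lp_ball p"
  shows "Re (peak_base p s z m y) \<le>
    (1 - lp_tail p m y / s powr p) / p - (\<Sum>i<m. young_gap p (z i) (y i)) / s powr p"
proof -
  define t a b G S where "t = (\<Sum>i<m. norm (z i) powr p)" and "a = (\<Sum>i<m. norm (y i) powr p)"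
    and "b = lp_tail p m y" and "G = (\<Sum>i<m. young_gap p (z i) (y i))" and "S = s powr p"
  have S: "0 < S" using s by (simp add: S_def)
  have ab: "a + b \<le> 1"
    using lp_tail_sums(2)[OF lp_ball_subset[OF y], of m] lp_suminf_powr_less_1[OF _ y] p by (simp add: a_def b_def)
  have "Re (\<Sum>i<m. young_dual p (z i) * y i) = (1 - 1 / p) * t + a / p - G"
    by (simp add: young_gap_def t_def a_def G_def sum.distrib sum_subtractf sum_distrib_left sum_divide_distrib)
  then have "Re (peak_base p s z m y) = ((1 - 1 / p) * t + a / p - G - (t + (1 - S - t) / p)) / S"
    unfolding peak_base_def Let_def t_def[symmetric] S_def[symmetric] Re_divide_of_real by simp
  also have "\<dots> \<le> ((S - b) / p - G) / S"
  proof (rule divide_right_mono)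
    have "(1 - 1 / p) * t + a / p - G - (t + (1 - S - t) / p) = (a - 1 + S) / p - G"
      using p by (simp add: field_simps)
    also have "\<dots> \<le> (S - b) / p - G" using ab p by (intro diff_right_mono divide_right_mono) auto
    finally show "(1 - 1 / p) * t + a / p - G - (t + (1 - S - t) / p) \<le> (S - b) / p - G" .
  qed (use S in simp)
  also have "\<dots> = (1 - b / S) / p - G / S" using S p by (simp add: field_simps)
  finally show ?thesis by (simp add: S_def b_def G_def)
qed

text \<open>
  The three factors on the right are at most 1 (for \<open>\<kappa> = 1\<close>), so if the left side is close to 1,
  each of them is.
\<close>

lemma norm_peak_fun_le:
  assumes p: "1 < p" and s: "0 < s" and y: "y \<in> lp_ball p" and n: "p < real n" and \<kappa>: "0 \<le> \<kappa>"
    and le: "\<And>j. j \<in> A \<Longrightarrow> m \<le> j \<Longrightarrow> norm (y j) powr p \<le> \<kappa> * lp_tail p m y"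
  defines "B \<equiv> lp_tail p m y / s powr p"
  shows "norm (peak_fun p s z A n m y) \<le> \<kappa> powr ((n - p) / p) *
    ((B * exp (1 - B)) powr (n / p) * exp (- (n / s powr p) * (\<Sum>i<m. young_gap p (z i) (y i))))"
proof -
  define b G where "b = lp_tail p m y" and "G = (\<Sum>i<m. young_gap p (z i) (y i))"
  have p0: "0 < p" using p by simp
  note yl = lp_ball_subset[OF y]
  have b: "0 \<le> b" unfolding b_def by (rule lp_tail_nonneg[OF yl])
  have B: "0 \<le> B" using b s by (simp add: B_def b_def)
  \<comment> \<open>Splits the exponent as p (1 + \<alpha>): one p-th power of each coordinate is
    summed to the tail mass, the remaining factor is estimated by the largest coordinate through
    \<kappa>.\<close>
  define \<alpha> where "\<alpha> = (n - p) / p"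
  have \<alpha>: "0 < \<alpha>" "1 + \<alpha> = n / p" using n p by (auto simp: \<alpha>_def field_simps)
  have pw: "norm (y j) ^ n = norm (y j) powr p * (norm (y j) powr p) powr \<alpha>" for j
  proof (cases "y j = 0")
    case False
    then have "norm (y j) ^ n = norm (y j) powr (p * (1 + \<alpha>))" using \<alpha> p0 by (simp add: powr_realpow)
    also have "\<dots> = norm (y j) powr p * (norm (y j) powr p) powr \<alpha>"
      by (simp add: powr_powr distrib_left flip: powr_add)
    finally show ?thesis .
  qed (use n p in \<open>cases n; simp\<close>)
  have ts: "(\<lambda>i. (if m \<le> i then norm (y i) powr p else 0) * (\<kappa> * b) powr \<alpha>) sums (b * (\<kappa> * b) powr \<alpha>)"
    unfolding b_def by (rule sums_mult2[OF lp_tail_sums(1)[OF yl]])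
  have "norm (\<Sum>j. if j \<in> A \<inter> {m..} then y j ^ n else 0) \<le>
      (\<Sum>i. (if m \<le> i then norm (y i) powr p else 0) * (\<kappa> * b) powr \<alpha>)"
  proof (rule suminf_norm_le_of_bound[OF sums_summable[OF ts]])
    fix j
    have "norm (y j) ^ n \<le> norm (y j) powr p * (\<kappa> * b) powr \<alpha>" if "j \<in> A" "m \<le> j"
      unfolding pw using le[OF that] \<alpha> by (intro mult_left_mono powr_mono2) (auto simp: b_def)
    then show "norm (if j \<in> A \<inter> {m..} then y j ^ n else 0) \<le> (if m \<le> j then norm (y j) powr p else 0) * (\<kappa> * b) powr \<alpha>"
      by (auto simp: norm_power)
  qed
  also have "\<dots> = b * (\<kappa> * b) powr \<alpha>" using ts by (simp add: sums_iff)
  also have "\<dots> = \<kappa> powr \<alpha> * b powr (n / p)"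
    using b \<kappa> by (simp add: powr_mult powr_mult_base \<alpha>(2)[symmetric])
  finally have Q: "norm (\<Sum>j. if j \<in> A \<inter> {m..} then y j ^ n else 0) \<le> \<kappa> powr \<alpha> * b powr (n / p)" .
  have "s ^ n = (s powr p) powr (n / p)" using s p0 by (simp add: powr_powr powr_realpow)
  then have Bn: "b powr (n / p) / s ^ n = B powr (n / p)"
    using b s by (simp add: B_def b_def powr_divide)
  have "real n * Re (peak_base p s z m y) \<le> real n * ((1 - B) / p - G / s powr p)"
    using Re_peak_base_le[OF p s y, of z m] by (intro mult_left_mono) (auto simp: B_def G_def)
  then have E: "norm (exp (of_nat n * peak_base p s z m y)) \<le> exp (real n * ((1 - B) / p - G / s powr p))"
    by simp
  have "norm (peak_fun p s z A n m y) = norm (exp (of_nat n * peak_base p s z m y)) *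
      norm (\<Sum>j. if j \<in> A \<inter> {m..} then y j ^ n else 0) / s ^ n"
    using s by (simp add: peak_fun_def norm_mult norm_divide norm_power)
  also have "\<dots> \<le> exp (real n * ((1 - B) / p - G / s powr p)) * (\<kappa> powr \<alpha> * b powr (n / p)) / s ^ n"
    using s by (intro divide_right_mono mult_mono E Q) auto
  also have "\<dots> = \<kappa> powr \<alpha> * (B powr (n / p) * exp (real n * ((1 - B) / p - G / s powr p)))"
    by (simp flip: Bn)
  \<comment> \<open>The part of the exponent that depends on \<open>B\<close> is isolated so that it
    merges with \<open>B powr (n / p)\<close> into one power of
    \<open>B * exp (1 - B)\<close>.\<close>
  also have "exp (real n * ((1 - B) / p - G / s powr p)) = exp ((1 - B) * (n / p)) * exp (- (n / s powr p) * G)"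
    by (simp add: algebra_simps flip: exp_add)
  also have "exp ((1 - B) * (n / p)) = exp (1 - B) powr (n / p)" by (simp add: exp_powr_real)
  finally show ?thesis
    using B by (simp add: powr_mult \<alpha>_def G_def mult.assoc)
qed

lemma peak_fun_in_Au:
  assumes "1 < p" "p + 2 \<le> real n"
  shows "(\<lambda>y. if y \<in> lp_ball p then peak_fun p s z A n m y else 0) \<in> Au p"
proof -
  have p: "1 \<le> p" using assms by simp
  define t where "t = (\<Sum>i<m. norm (z i) powr p)"
  let ?l = "\<lambda>y. if y \<in> lp_ball p then \<Sum>i<m. young_dual p (z i) * y i else 0"
  let ?c = "of_nat n / of_real (s powr p) :: complex"
  let ?d = "- ?c * of_real (t + (1 - s powr p - t) / p)"
  let ?a = "\<lambda>y. if y \<in> lp_ball p then ?c * ?l y + ?d else 0"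
  let ?e = "\<lambda>y. if y \<in> lp_ball p then exp (?a y) else 0"
  let ?q = "\<lambda>y. if y \<in> lp_ball p then \<Sum>j. if j \<in> A \<inter> {m..} then y j ^ n else 0 else 0"
  have "(\<lambda>y. inverse (of_real (s ^ n)) * (?e * ?q) y) \<in> Au p"
    by (intro Au_scale[OF p] Au_mult[OF p] Au_exp[OF p] Au_affine[OF p] Au_linear_sum[OF p] Au_power_sum[OF p assms(2)])
  moreover have "inverse (of_real (s ^ n)) * (?e * ?q) y = (if y \<in> lp_ball p then peak_fun p s z A n m y else 0)" for y
  proof (cases "y \<in> lp_ball p")
    case True
    have "?c * (\<Sum>i<m. young_dual p (z i) * y i) + ?d = of_nat n * peak_base p s z m y"
      unfolding peak_base_def Let_def t_def[symmetric] by (simp add: diff_divide_distrib right_diff_distrib)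
    then show ?thesis using True by (simp add: peak_fun_def divide_inverse mult_ac)
  qed simp
  ultimately show ?thesis by simp
qed

lemma norm_peak_fun_le_1:
  assumes "1 < p" "0 < s" "y \<in> lp_ball p" "p < real n"
  shows "norm (peak_fun p s z A n m y) \<le> 1"
proof -
  let ?B = "lp_tail p m y / s powr p" and ?G = "\<Sum>i<m. young_gap p (z i) (y i)"
  have B: "0 \<le> ?B" using lp_tail_nonneg[OF lp_ball_subset[OF assms(3)]] by simp
  have "norm (peak_fun p s z A n m y) \<le> 1 powr ((n - p) / p) *
      ((?B * exp (1 - ?B)) powr (n / p) * exp (- (n / s powr p) * ?G))"
    by (rule norm_peak_fun_le[OF assms]) (auto intro: coord_le_lp_tail lp_ball_subset[OF assms(3)])
  also have "\<dots> \<le> 1 * (1 * 1)"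
  proof (intro mult_mono)
    have "(?B * exp (1 - ?B)) powr (n / p) \<le> 1 powr (n / p)"
      using assms by (intro powr_mono2 mult_nonneg_nonneg B mult_exp_le_1) auto
    then show "(?B * exp (1 - ?B)) powr (n / p) \<le> 1" by simp
    have "0 \<le> ?G" by (intro sum_nonneg young_gap_nonneg assms)
    then show "exp (- (n / s powr p) * ?G) \<le> 1" by simp
  qed auto
  finally show ?thesis by simp
qed

section \<open>The points \<open>x k\<close>: values of the peak functions and distances\<close>

definition boundary_point :: "real \<Rightarrow> (nat \<Rightarrow> complex) \<Rightarrow> nat \<Rightarrow> nat \<Rightarrow> complex" where
  "boundary_point s z k = lp_proj k z + (\<lambda>i. of_real s * lp_unit k i)"

lemma boundary_point_apply:
  "boundary_point s z k i = (if i < k then z i else if i = k then of_real s else 0)"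
  by (simp add: boundary_point_def lp_proj_def lp_unit_def)

lemma boundary_point_closed_ball:
  assumes p: "0 < p" and s: "0 < s" and z: "z \<in> lp_space p" and zs: "(\<Sum>i. norm (z i) powr p) = 1 - s powr p"
  shows "boundary_point s z k \<in> lp_space p" "lp_norm p (boundary_point s z k) \<le> 1"
proof -
  have sm: "(\<lambda>i. (if i \<in> {..<k} then norm (z i) powr p else 0) + (if i = k then s powr p else 0)) sums
      ((\<Sum>i<k. norm (z i) powr p) + s powr p)"
    by (intro sums_add sums_If_finite_set sums_single) simp
  have eq: "(\<lambda>i. (if i \<in> {..<k} then norm (z i) powr p else 0) + (if i = k then s powr p else 0)) =
      (\<lambda>i. norm (boundary_point s z k i) powr p)"
    using s by (intro ext) (auto simp: boundary_point_apply)
  from sm have "(\<lambda>i. norm (boundary_point s z k i) powr p) sums ((\<Sum>i<k. norm (z i) powr p) + s powr p)"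
    unfolding eq .
  note S = sums_summable[OF this] sums_unique[OF this]
  show b: "boundary_point s z k \<in> lp_space p" using S(1) by (simp add: lp_space_def)
  have "(\<Sum>i<k. norm (z i) powr p) + s powr p \<le> 1"
    using lp_tail_sums(2)[OF z, of k] lp_tail_nonneg[OF z, of k] zs by linarith
  then show "lp_norm p (boundary_point s z k) \<le> 1"
    unfolding lp_norm_le_iff[OF p b zero_le_one] S(2)[symmetric] by simp
qed

text \<open>Since \<open>m \<le> k\<close>, the functional takes the value \<open>t\<close> at the
  point, and only the correction term remains in the exponent: this is the first defect. The second
  one consists of the powers of coordinates of z between m and k, which add up to at most the tail
  mass of z. The point may lie on the sphere, so its value is computed as a radial limit.\<close>

lemma eval_peak_fun_near_1:
  assumes p: "1 < p" and s: "0 < s" and z: "z \<in> lp_space p" and zs: "(\<Sum>i. norm (z i) powr p) = 1 - s powr p"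
    and n: "p + 2 \<le> real n" and k: "k \<in> A" "m \<le> k"
  shows "norm (eval_hom p (boundary_point s z k) (\<lambda>y. if y \<in> lp_ball p then peak_fun p s z A n m y else 0) - 1)
    \<le> (1 - exp (- (real n / (p * s powr p)) * lp_tail p m z)) + lp_tail p m z / s ^ n"
proof -
  let ?F = "\<lambda>y. if y \<in> lp_ball p then peak_fun p s z A n m y else 0"
  let ?x = "boundary_point s z k"
  have p0: "0 < p" and p1: "1 \<le> p" using p by auto
  define t S \<epsilon> W where "t = (\<Sum>i<m. norm (z i) powr p)" and "S = s powr p" and "\<epsilon> = lp_tail p m z"
    and "W = (\<Sum>j\<in>A \<inter> {m..<k}. z j ^ n)"
  have S0: "0 < S" using s by (simp add: S_def)
  have \<epsilon>: "\<epsilon> = 1 - S - t" using lp_tail_sums(2)[OF z, of m] zs by (simp add: \<epsilon>_def S_def t_def)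
  have \<epsilon>0: "0 \<le> \<epsilon>" unfolding \<epsilon>_def by (rule lp_tail_nonneg[OF z])
  note x = boundary_point_closed_ball[OF p0 s z zs, of k]
  have F: "?F \<in> Au p" by (rule peak_fun_in_Au[OF p n])
  \<comment> \<open>A closed formula in r, in which the limit at 1 can be taken directly.\<close>
  have pk: "peak_fun p s z A n m (\<lambda>i. of_real r * ?x i) =
      exp (of_nat n * ((of_real r * of_real t - of_real (t + \<epsilon> / p)) / of_real S)) *
      (of_real r ^ n * (of_real s ^ n + W)) / of_real (s ^ n)" for r :: real
  proof -
    have "(\<Sum>i<m. young_dual p (z i) * (of_real r * ?x i)) = (\<Sum>i<m. of_real r * of_real (norm (z i) powr p))"
    proof (rule sum.cong)
      fix i assume "i \<in> {..<m}"
      then have "?x i = z i" using k(2) by (simp add: boundary_point_apply)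
      then have "young_dual p (z i) * (of_real r * ?x i) = of_real r * (young_dual p (z i) * z i)" by simp
      then show "young_dual p (z i) * (of_real r * ?x i) = of_real r * of_real (norm (z i) powr p)"
        by (simp only: young_dual_self[OF p0])
    qed simp
    also have "\<dots> = of_real r * of_real t" by (simp add: t_def sum_distrib_left)
    finally have base: "peak_base p s z m (\<lambda>i. of_real r * ?x i) =
        (of_real r * of_real t - of_real (t + \<epsilon> / p)) / of_real S"
      unfolding peak_base_def Let_def t_def[symmetric] S_def[symmetric] \<epsilon> by simp
    have "(\<Sum>j. if j \<in> A \<inter> {m..} then (of_real r * ?x j) ^ n else 0) =
        (\<Sum>j\<in>A \<inter> {m..k}. if j \<in> A \<inter> {m..} then (of_real r * ?x j) ^ n else 0)"
      using n p by (intro suminf_finite) (auto simp: boundary_point_apply)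
    also have "A \<inter> {m..k} = insert k (A \<inter> {m..<k})" using k by auto
    also have "(\<Sum>j\<in>insert k (A \<inter> {m..<k}). if j \<in> A \<inter> {m..} then (of_real r * ?x j) ^ n else 0) =
        of_real r ^ n * of_real s ^ n + (\<Sum>j\<in>A \<inter> {m..<k}. of_real r ^ n * z j ^ n)"
      using k by (subst sum.insert) (auto simp: boundary_point_apply power_mult_distrib intro!: sum.cong)
    also have "\<dots> = of_real r ^ n * (of_real s ^ n + W)"
      by (simp add: W_def distrib_left sum_distrib_left)
    finally show ?thesis unfolding peak_fun_def base by simp
  qed
  define v where "v = exp (of_nat n * ((of_real 1 * of_real t - of_real (t + \<epsilon> / p)) / of_real S)) *
      (of_real 1 ^ n * (of_real s ^ n + W)) / of_real (s ^ n)"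
  have lim: "((\<lambda>r. peak_fun p s z A n m (\<lambda>i. of_real r * ?x i)) \<longlongrightarrow> v) (at_left 1)"
    unfolding pk v_def using S0 s by (intro tendsto_intros) auto
  have "\<forall>\<^sub>F r in at_left (1::real). (\<lambda>i. of_real r * ?x i) \<in> lp_ball p"
    using p0 x by (intro eventually_at_leftI[of 0]) (auto intro!: lp_ball_scale)
  then have "\<forall>\<^sub>F r in at_left (1::real). peak_fun p s z A n m (\<lambda>i. of_real r * ?x i) = ?F (\<lambda>i. of_real r * ?x i)"
    by eventually_elim simp
  then have "((\<lambda>r. ?F (\<lambda>i. of_real r * ?x i)) \<longlongrightarrow> v) (at_left 1)"
    by (rule Lim_transform_eventually[OF lim])
  then have ext: "Au_extension p ?F ?x = v"
    using Au_radial_limit[OF p1 F x] tendsto_unique[OF trivial_limit_at_left_real] by blast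
  define E where "E = exp (- (real n / (p * S)) * \<epsilon>)"
  have E: "0 < E" "E \<le> 1" using S0 p0 \<epsilon>0 by (auto simp: E_def)
  have "exp (of_nat n * ((of_real 1 * of_real t - of_real (t + \<epsilon> / p)) / of_real S)) = complex_of_real E"
    unfolding E_def exp_of_real[symmetric] by (rule arg_cong[of _ _ exp]) (simp add: field_simps)
  then have "v - 1 = of_real (E - 1) + of_real (E / s ^ n) * W"
    using s by (simp add: v_def field_simps)
  then have "norm (v - 1) \<le> \<bar>E - 1\<bar> + E / s ^ n * norm W"
    using norm_triangle_ineq[of "of_real (E - 1)" "of_real (E / s ^ n) * W"] E s
    by (simp add: norm_mult norm_divide norm_power del: of_real_diff of_real_divide)
  also have "\<dots> \<le> (1 - E) + 1 / s ^ n * \<epsilon>"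
  proof (rule add_mono)
    have z1: "norm (z j) \<le> 1" for j
    proof -
      have "norm (z j) powr p \<le> 1 powr p"
        using coord_le_lp_tail[OF z, of 0 j] lp_tail_sums(2)[OF z, of 0] zs powr_ge_zero[of s p]
        by (simp del: powr_ge_zero)
      then show ?thesis using p0 by (metis norm_ge_zero not_le powr_less_mono2 zero_le_one)
    qed
    have "norm W \<le> (\<Sum>j\<in>A \<inter> {m..<k}. norm (z j) powr p)"
      unfolding W_def
      using p0 n power_le_powr[OF norm_ge_zero z1, of p n] by (intro sum_norm_le) (simp add: norm_power)
    also have "\<dots> = (\<Sum>j\<in>A \<inter> {m..<k}. if m \<le> j then norm (z j) powr p else 0)"
      by (intro sum.cong) auto
    also have "\<dots> \<le> \<epsilon>"
      unfolding \<epsilon>_def lp_tail_def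
      by (intro sum_le_suminf sums_summable[OF lp_tail_sums(1)[OF z]]) auto
    finally show "E / s ^ n * norm W \<le> 1 / s ^ n * \<epsilon>"
      using E s by (intro mult_mono divide_right_mono) auto
  qed (use E in simp)
  finally show ?thesis
    using F ext by (simp add: eval_hom_def E_def \<epsilon>_def S_def)
qed

text \<open>The head is compared with z and coordinate \<open>j\<close> with s. The other
  coordinates are estimated crudely by the masses of y and z; this is affordable because nearly all
  of the tail mass of y will sit at \<open>j\<close>.\<close>

lemma dist_boundary_point_le:
  assumes p: "1 < p" and s: "0 < s" and y: "y \<in> lp_space p" and z: "z \<in> lp_space p"
    and zs: "(\<Sum>i. norm (z i) powr p) = 1 - s powr p" and mj: "m \<le> j"
  shows "(\<Sum>i. norm ((y - boundary_point s z j) i) powr p) \<le>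
    (\<Sum>i<m. norm (y i - z i) powr p) + norm (y j - of_real s) powr p +
    2 powr p * (lp_tail p m y - norm (y j) powr p) + 2 powr p * lp_tail p m z"
proof -
  have p0: "0 < p" using p by simp
  let ?f = "\<lambda>i. (if i \<in> {..<m} then norm (y i - z i) powr p else 0) + (if i = j then norm (y i - of_real s) powr p else 0) +
    2 powr p * ((if m \<le> i then norm (y i) powr p else 0) - (if i = j then norm (y i) powr p else 0)) +
    2 powr p * (if m \<le> i then norm (z i) powr p else 0)"
  have f: "?f sums ((\<Sum>i<m. norm (y i - z i) powr p) + norm (y j - of_real s) powr p +
    2 powr p * (lp_tail p m y - norm (y j) powr p) + 2 powr p * lp_tail p m z)"
    by (intro sums_add sums_mult sums_diff sums_If_finite_set sums_single lp_tail_sums(1) y z) simp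
  have "y - boundary_point s z j \<in> lp_space p"
    by (rule lp_space_diff[OF p0 y boundary_point_closed_ball(1)[OF p0 s z zs]])
  then have h: "(\<lambda>i. norm ((y - boundary_point s z j) i) powr p) sums (\<Sum>i. norm ((y - boundary_point s z j) i) powr p)"
    by (intro summable_sums lp_summable)
  show ?thesis
  proof (rule sums_le[OF _ h f])
    fix i
    have d: "norm (y i - z i) powr p \<le> 2 powr p * norm (y i) powr p + 2 powr p * norm (z i) powr p"
      using norm_add_powr_le[OF p0, of "y i" "- z i"] by (simp add: distrib_left)
    have "1 \<le> 2 powr p" using p0 by (simp add: ge_one_powr_ge_zero)
    then have d': "norm (y i) powr p \<le> 2 powr p * norm (y i) powr p"
      using mult_right_mono[of 1 "2 powr p" "norm (y i) powr p"] by simp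
    consider "i < m" | "m \<le> i" "i < j" | "i = j" | "j < i" by linarith
    then show "norm ((y - boundary_point s z j) i) powr p \<le> ?f i"
    proof cases
      case 1
      then show ?thesis using mj by (simp add: boundary_point_apply)
    next
      case 2
      then show ?thesis using d by (simp add: boundary_point_apply)
    next
      case 3
      then show ?thesis using mj by (simp add: boundary_point_apply)
    next
      case 4
      then show ?thesis using d' mj by (simp add: boundary_point_apply add_increasing2)
    qed
  qed
qed

text \<open>Coordinates have modulus at most 1, so n-th powers are dominated by p-th powers, and
  everything besides \<open>j\<close> is controlled by the tail mass not located at
  \<open>j\<close>.\<close>

lemma power_sum_dominant_term:
  assumes p: "0 < p" and y: "y \<in> lp_ball p" and n: "p \<le> real n" and j: "j \<in> A" "m \<le> j"
  shows "norm ((\<Sum>i. if i \<in> A \<inter> {m..} then y i ^ n else 0) - y j ^ n) \<le> lp_tail p m y - norm (y j) powr p"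
proof -
  note yl = lp_ball_subset[OF y]
  have f: "(\<lambda>i. (if i \<in> A \<inter> {m..} then y i ^ n else 0) - (if i = j then y i ^ n else 0)) sums
      ((\<Sum>i. if i \<in> A \<inter> {m..} then y i ^ n else 0) - y j ^ n)"
    by (intro sums_diff sums_single summable_sums lp_power_summable[OF p y n])
  have g: "(\<lambda>i. (if m \<le> i then norm (y i) powr p else 0) - (if i = j then norm (y i) powr p else 0)) sums
      (lp_tail p m y - norm (y j) powr p)"
    by (intro sums_diff sums_single lp_tail_sums(1) yl)
  have "norm (suminf (\<lambda>i. (if i \<in> A \<inter> {m..} then y i ^ n else 0) - (if i = j then y i ^ n else 0))) \<le>
      suminf (\<lambda>i. (if m \<le> i then norm (y i) powr p else 0) - (if i = j then norm (y i) powr p else 0))"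
  proof (rule suminf_norm_le_of_bound[OF sums_summable[OF g]])
    fix i
    have "norm (y i) ^ n \<le> norm (y i) powr p"
      by (rule power_le_powr[OF norm_ge_zero norm_coord_le_1[OF p y] p n])
    then show "norm ((if i \<in> A \<inter> {m..} then y i ^ n else 0) - (if i = j then y i ^ n else 0)) \<le>
        (if m \<le> i then norm (y i) powr p else 0) - (if i = j then norm (y i) powr p else 0)"
      using j by (auto simp: norm_power)
  qed
  then show ?thesis using sums_unique[OF f] sums_unique[OF g] by simp
qed

text \<open>The factors squeezed to 1 carry separate information: the tail mass tends to
  \<open>s powr p\<close>, the gaps between the head and z vanish, and a single coordinate in
  \<open>A\<close> carries almost all of the tail mass. Moduli do not determine the phase of that
  coordinate; it is recovered from the complex limits for the two exponents.\<close>

lemma peak_fun_concentration: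
  fixes y :: "nat \<Rightarrow> nat \<Rightarrow> complex"
  assumes p: "1 < p" and s: "0 < s" and z: "z \<in> lp_space p" and zs: "(\<Sum>i. norm (z i) powr p) = 1 - s powr p"
    and n: "p < real n" and y: "\<And>m. y m \<in> lp_ball p"
    and lim: "(\<lambda>m. peak_fun p s z A n m (y m)) \<longlonglongrightarrow> 1"
    and lim': "(\<lambda>m. peak_fun p s z A (Suc n) m (y m)) \<longlonglongrightarrow> 1"
  obtains j where "\<forall>\<^sub>F m in sequentially. j m \<in> A"
    "(\<lambda>m. lp_norm p (y m - boundary_point s z (j m))) \<longlonglongrightarrow> 0"
proof -
  have p0: "0 < p" and n0: "0 < real n" using p n by auto
  define S where "S = s powr p"
  have S: "0 < S" using s by (simp add: S_def)
  note yl = lp_ball_subset[OF y] and y1 = lp_suminf_powr_less_1[OF p0 y]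
  define b where "b m = lp_tail p m (y m)" for m
  define B where "B m = b m / S" for m
  define G where "G m = (\<Sum>i<m. young_gap p (z i) (y m i))" for m
  define P where "P m = norm (peak_fun p s z A n m (y m))" for m
  have P1: "P \<longlonglongrightarrow> 1" unfolding P_def using tendsto_norm[OF lim] by simp
  have b: "0 \<le> b m" "b m \<le> 1" for m
  proof -
    show "0 \<le> b m" unfolding b_def by (rule lp_tail_nonneg[OF yl])
    have "0 \<le> (\<Sum>i<m. norm (y m i) powr p)" by (intro sum_nonneg) simp
    then show "b m \<le> 1" using lp_tail_sums(2)[OF yl, of m m] y1[of m] by (simp add: b_def)
  qed
  have B: "0 \<le> B m" "B m \<le> 1 / S" for m using b S by (auto simp: B_def divide_right_mono)
  have G: "0 \<le> G m" for m unfolding G_def by (intro sum_nonneg young_gap_nonneg p)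
  have bound: "P m \<le> \<kappa> powr ((n - p) / p) * ((B m * exp (1 - B m)) powr (n / p) * exp (- (n / S) * G m))"
    if "0 \<le> \<kappa>" "\<And>j. j \<in> A \<Longrightarrow> m \<le> j \<Longrightarrow> norm (y m j) powr p \<le> \<kappa> * b m" for \<kappa> m
    unfolding P_def B_def b_def S_def G_def using that unfolding b_def by (intro norm_peak_fun_le p s y n)
  have h1: "(B m * exp (1 - B m)) powr (n / p) \<le> 1" for m
  proof -
    have "(B m * exp (1 - B m)) powr (n / p) \<le> 1 powr (n / p)"
      using p0 by (intro powr_mono2 mult_nonneg_nonneg B mult_exp_le_1) auto
    then show ?thesis by simp
  qed
  have e1: "exp (- (n / S) * G m) \<le> 1" for m using S G by simp
  have bound1: "P m \<le> (B m * exp (1 - B m)) powr (n / p) * exp (- (n / S) * G m)" for m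
    using bound[of 1 m] coord_le_lp_tail[OF yl] by (simp add: b_def)
  have Ph: "P m \<le> (B m * exp (1 - B m)) powr (n / p)" for m
    using bound1[of m] mult_left_mono[OF e1[of m], of "(B m * exp (1 - B m)) powr (n / p)"] by simp
  have Pe: "P m \<le> exp (- (n / S) * G m)" for m
    by (rule order_trans[OF bound1[of m] mult_right_mono[OF h1[of m] exp_ge_zero, unfolded mult_1]])

  have "(\<lambda>m. B m * exp (1 - B m)) \<longlonglongrightarrow> 1"
  proof (rule tendsto_sandwich)
    \<comment> \<open>Undoes the power \<open>n / p\<close>, so that the sandwich applies to
      \<open>B m * exp (1 - B m)\<close> itself.\<close>
    have "(\<lambda>m. P m powr (p / n)) \<longlonglongrightarrow> 1 powr (p / n)" by (intro tendsto_intros P1) auto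
    then show "(\<lambda>m. P m powr (p / n)) \<longlonglongrightarrow> 1" by simp
    have "P m powr (p / n) \<le> B m * exp (1 - B m)" for m
    proof -
      have "P m powr (p / n) \<le> ((B m * exp (1 - B m)) powr (n / p)) powr (p / n)"
        using Ph p0 by (intro powr_mono2) (auto simp: P_def)
      also have "\<dots> = B m * exp (1 - B m)" using B(1) p0 n0 by (simp add: powr_powr)
      finally show ?thesis .
    qed
    then show "\<forall>\<^sub>F m in sequentially. P m powr (p / n) \<le> B m * exp (1 - B m)" by simp
  qed (auto simp: mult_exp_le_1)
  then have B1: "B \<longlonglongrightarrow> 1"
    by (intro tendsto_unique_maximizer[of "{0..1 / S}" "\<lambda>b. b * exp (1 - b)" 1])
      (use B mult_exp_less_1 in \<open>auto intro!: continuous_intros\<close>)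
  have bS: "b \<longlonglongrightarrow> S"
    using tendsto_mult[OF B1 tendsto_const[of S]] S by (simp add: B_def)

  have "(\<lambda>m. exp (- (n / S) * G m)) \<longlonglongrightarrow> 1"
    by (rule tendsto_sandwich[OF _ _ P1 tendsto_const]) (use Pe e1 in auto)
  then have "(\<lambda>m. ln (exp (- (n / S) * G m))) \<longlonglongrightarrow> ln 1" by (intro tendsto_ln) auto
  then have "(\<lambda>m. - (S / n) * (- (n / S) * G m)) \<longlonglongrightarrow> - (S / n) * 0"
    by (intro tendsto_mult tendsto_const) simp
  then have G0: "G \<longlonglongrightarrow> 0" using S n0 by simp

  \<comment> \<open>Chosen so that, for \<open>0 < P m\<close>,
    \<open>\<kappa> m powr ((n - p) / p)\<close> is \<open>P m\<close> times a factor below 1. If no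
    coordinate in \<open>A\<close> exceeded the share \<open>\<kappa> m\<close> of the tail mass,
    the bound would read P m < P m. The factor supplies the strictness and tends to 1.\<close>
  define \<kappa> where "\<kappa> m = (P m * (1 - inverse (real (Suc m)))) powr (p / (n - p))" for m
  have "(\<lambda>m. P m * (1 - inverse (real (Suc m)))) \<longlonglongrightarrow> 1 * (1 - 0)"
    by (intro tendsto_intros P1 LIMSEQ_inverse_real_of_nat)
  then have "\<kappa> \<longlonglongrightarrow> (1 * (1 - 0)) powr (p / (n - p))"
    unfolding \<kappa>_def by (intro tendsto_powr tendsto_const) auto
  then have \<kappa>1: "\<kappa> \<longlonglongrightarrow> 1" by simp
  have Ppos: "\<forall>\<^sub>F m in sequentially. 0 < P m" using order_tendstoD(1)[OF P1] by simp
  have ex: "\<exists>j\<in>A. m \<le> j \<and> \<kappa> m * b m < norm (y m j) powr p" if P: "0 < P m" for m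
  proof (rule ccontr)
    assume "\<not> ?thesis"
    then have "P m \<le> \<kappa> m powr ((n - p) / p) * ((B m * exp (1 - B m)) powr (n / p) * exp (- (n / S) * G m))"
      by (intro bound) (auto simp: \<kappa>_def not_less)
    also have "\<dots> \<le> \<kappa> m powr ((n - p) / p) * (1 * 1)"
      using h1 e1 by (intro mult_left_mono mult_mono) auto
    also have "\<dots> = P m * (1 - inverse (real (Suc m)))"
      using p0 n P by (simp add: \<kappa>_def powr_powr field_simps)
    also have "\<dots> < P m * 1" using P by (intro mult_strict_left_mono) auto
    finally show False by simp
  qed
  then obtain j where j: "\<And>m. 0 < P m \<Longrightarrow> j m \<in> A \<and> m \<le> j m \<and> \<kappa> m * b m < norm (y m (j m)) powr p"
    by metis
  have jA: "\<forall>\<^sub>F m in sequentially. j m \<in> A" using Ppos by eventually_elim (use j in blast)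

  define V where "V m = norm (y m (j m)) powr p" for m
  have VS: "V \<longlonglongrightarrow> S"
  proof (rule tendsto_sandwich[OF _ _ _ bS])
    show "(\<lambda>m. \<kappa> m * b m) \<longlonglongrightarrow> S" using tendsto_mult[OF \<kappa>1 bS] by simp
    show "\<forall>\<^sub>F m in sequentially. \<kappa> m * b m \<le> V m"
      using Ppos by eventually_elim (use j in \<open>auto simp: V_def less_imp_le\<close>)
    show "\<forall>\<^sub>F m in sequentially. V m \<le> b m"
      using Ppos by eventually_elim (use j coord_le_lp_tail[OF yl] in \<open>auto simp: V_def b_def\<close>)
  qed
  have bV: "(\<lambda>m. b m - V m) \<longlonglongrightarrow> 0" using tendsto_diff[OF bS VS] by simp

  \<comment> \<open>The first term measures the distance of the head from z, the second dominates
    the change of the functional between them.\<close>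
  define H where "H m = (\<Sum>i<m. norm (y m i - z i) powr p + norm (z i) powr (p - 1) * norm (y m i - z i))" for m
  have H0: "H \<longlonglongrightarrow> 0"
  proof (rule tendstoI)
    fix e :: real assume e: "0 < e"
    \<comment> \<open>The head masses of z and \<open>y m\<close> add up to at most 2, so this share
      contributes at most \<open>e / 2\<close>.\<close>
    then have "0 < e / 4" by simp
    then obtain C where C: "0 \<le> C" "\<And>w u. norm (u - w) powr p + norm w powr (p - 1) * norm (u - w) \<le>
        e / 4 * (norm w powr p + norm u powr p) + C * young_gap p w u"
      using young_gap_controls[OF p] by blast
    have Hle: "H m \<le> e / 2 + C * G m" for m
    proof -
      have "(\<Sum>i<m. norm (z i) powr p) \<le> 1" "(\<Sum>i<m. norm (y m i) powr p) \<le> 1"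
        using sum_le_suminf[OF lp_summable[OF z], of "{..<m}"] zs[folded S_def] S y1[of m]
          sum_le_suminf[OF lp_summable[OF yl[of m]], of "{..<m}"] by auto
      then have "e / 4 * ((\<Sum>i<m. norm (z i) powr p) + (\<Sum>i<m. norm (y m i) powr p)) \<le> e / 4 * 2"
        using e by (intro mult_left_mono) auto
      moreover have "H m \<le> e / 4 * ((\<Sum>i<m. norm (z i) powr p) + (\<Sum>i<m. norm (y m i) powr p)) + C * G m"
        unfolding H_def G_def sum_distrib_left sum.distrib[symmetric] by (intro sum_mono C(2))
      ultimately show ?thesis by simp
    qed
    have "(\<lambda>m. C * G m) \<longlonglongrightarrow> C * 0" by (intro tendsto_intros G0)
    then have "\<forall>\<^sub>F m in sequentially. C * G m < e / 2" using e by (intro order_tendstoD(2)) auto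
    then show "\<forall>\<^sub>F m in sequentially. dist (H m) 0 < e"
    proof eventually_elim
      case (elim m)
      have "0 \<le> H m" unfolding H_def by (intro sum_nonneg) simp
      then show ?case using Hle[of m] elim by simp
    qed
  qed

  define t where "t m = (\<Sum>i<m. norm (z i) powr p)" for m
  have t: "t \<longlonglongrightarrow> 1 - S"
    unfolding t_def using summable_LIMSEQ[OF lp_summable[OF z]] zs by (simp add: S_def)
  \<comment> \<open>Makes the exponential factor tend to 1 as a complex number, not only in modulus,
    so that it can be divided out and leaves the power sum.\<close>
  have "(\<lambda>m. (\<Sum>i<m. young_dual p (z i) * y m i) - of_real (t m)) \<longlonglongrightarrow> 0"
  proof (rule Lim_null_comparison[OF _ H0])
    have "norm ((\<Sum>i<m. young_dual p (z i) * y m i) - of_real (t m)) \<le> H m" for m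
    proof -
      have "(\<Sum>i<m. young_dual p (z i) * y m i) - of_real (t m) = (\<Sum>i<m. young_dual p (z i) * (y m i - z i))"
        by (simp add: t_def sum_subtractf right_diff_distrib young_dual_self[OF p0])
      also have "norm \<dots> \<le> H m"
        unfolding H_def by (intro sum_norm_le) (simp add: norm_mult norm_young_dual)
      finally show ?thesis .
    qed
    then show "\<forall>\<^sub>F m in sequentially. norm ((\<Sum>i<m. young_dual p (z i) * y m i) - of_real (t m)) \<le> H m" by simp
  qed
  moreover have "(\<lambda>m. of_real ((1 - S - t m) / p) :: complex) \<longlonglongrightarrow> of_real ((1 - S - (1 - S)) / p)"
    using p0 by (intro tendsto_intros t) auto
  ultimately have "(\<lambda>m. (((\<Sum>i<m. young_dual p (z i) * y m i) - of_real (t m)) - of_real ((1 - S - t m) / p)) / of_real S)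
      \<longlonglongrightarrow> (0 - of_real ((1 - S - (1 - S)) / p)) / of_real S"
    using S by (intro tendsto_divide tendsto_diff tendsto_const) auto
  then have "(\<lambda>m. peak_base p s z m (y m)) \<longlonglongrightarrow> 0"
    by (simp add: peak_base_def Let_def t_def S_def diff_diff_add)
  then have E1: "(\<lambda>m. exp (of_nat k * peak_base p s z m (y m))) \<longlonglongrightarrow> 1" for k :: nat
    by (auto intro!: tendsto_eq_intros)

  have yk: "(\<lambda>m. y m (j m) ^ k) \<longlonglongrightarrow> of_real s ^ k"
    if k: "p \<le> real k" and limk: "(\<lambda>m. peak_fun p s z A k m (y m)) \<longlonglongrightarrow> 1" for k
  proof -
    define Q where "Q m = (\<Sum>i. if i \<in> A \<inter> {m..} then y m i ^ k else 0)" for m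
    have "(\<lambda>m. peak_fun p s z A k m (y m) * of_real (s ^ k) / exp (of_nat k * peak_base p s z m (y m)))
        \<longlonglongrightarrow> 1 * of_real (s ^ k) / 1"
      by (intro tendsto_intros limk E1) auto
    then have Q: "Q \<longlonglongrightarrow> of_real (s ^ k)" using s by (simp add: peak_fun_def Q_def[abs_def])
    have "(\<lambda>m. Q m - y m (j m) ^ k) \<longlonglongrightarrow> 0"
    proof (rule Lim_null_comparison[OF _ bV])
      show "\<forall>\<^sub>F m in sequentially. norm (Q m - y m (j m) ^ k) \<le> b m - V m"
        using Ppos
      proof eventually_elim
        case (elim m)
        then show ?case
          unfolding Q_def b_def V_def using j[OF elim] by (intro power_sum_dominant_term p0 y k) auto
      qed
    qed
    from tendsto_diff[OF Q this] show ?thesis by simp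
  qed
  have yn: "(\<lambda>m. y m (j m) ^ n) \<longlonglongrightarrow> of_real s ^ n" using n by (intro yk lim) auto
  have yn': "(\<lambda>m. y m (j m) ^ Suc n) \<longlonglongrightarrow> of_real s ^ Suc n" using n by (intro yk lim') auto
  \<comment> \<open>One power fixes the coordinate only up to a root of unity; the quotient of
    consecutive powers removes this ambiguity.\<close>
  have "(\<lambda>m. y m (j m) ^ Suc n / y m (j m) ^ n) \<longlonglongrightarrow> of_real s ^ Suc n / of_real s ^ n"
    using s by (intro tendsto_divide yn yn') auto
  then have "(\<lambda>m. y m (j m) ^ Suc n / y m (j m) ^ n) \<longlonglongrightarrow> of_real s" using s by simp
  moreover have "\<forall>\<^sub>F m in sequentially. y m (j m) ^ Suc n / y m (j m) ^ n = y m (j m)"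
  proof -
    have "\<forall>\<^sub>F m in sequentially. y m (j m) ^ n \<noteq> 0" using s by (intro tendsto_imp_eventually_ne[OF yn]) auto
    then show ?thesis by eventually_elim auto
  qed
  ultimately have ys: "(\<lambda>m. y m (j m)) \<longlonglongrightarrow> of_real s" by (rule Lim_transform_eventually)

  let ?D = "\<lambda>m. \<Sum>i. norm ((y m - boundary_point s z (j m)) i) powr p"
  have bp: "y m - boundary_point s z (j m) \<in> lp_space p" for m
    by (rule lp_space_diff[OF p0 yl boundary_point_closed_ball(1)[OF p0 s z zs]])
  have "?D \<longlonglongrightarrow> 0"
  proof (rule tendsto_sandwich[OF _ _ tendsto_const])
    show "\<forall>\<^sub>F m in sequentially. 0 \<le> ?D m" using lp_suminf_nonneg[OF bp] by simp
    have "(\<lambda>m. norm (y m (j m) - of_real s)) \<longlonglongrightarrow> 0" using ys by (simp add: tendsto_norm_zero_iff LIM_zero_iff)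
    then have "(\<lambda>m. norm (y m (j m) - of_real s) powr p) \<longlonglongrightarrow> 0"
      using p0 by (intro tendsto_zero_powrI[OF _ tendsto_const]) auto
    then have "(\<lambda>m. H m + norm (y m (j m) - of_real s) powr p + 2 powr p * (b m - V m) + 2 powr p * lp_tail p m z)
      \<longlonglongrightarrow> 0 + 0 + 2 powr p * 0 + 2 powr p * 0"
      by (intro tendsto_intros H0 bV lp_tail_tendsto_0 z)
    then show "(\<lambda>m. H m + norm (y m (j m) - of_real s) powr p + 2 powr p * (b m - V m) + 2 powr p * lp_tail p m z)
      \<longlonglongrightarrow> 0" by simp
    show "\<forall>\<^sub>F m in sequentially. ?D m \<le>
        H m + norm (y m (j m) - of_real s) powr p + 2 powr p * (b m - V m) + 2 powr p * lp_tail p m z"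
      using Ppos
    proof eventually_elim
      case (elim m)
      have "(\<Sum>i<m. norm (y m i - z i) powr p) \<le> H m" unfolding H_def by (intro sum_mono) simp
      then show ?case
        using dist_boundary_point_le[OF p s yl[of m] z zs, of m "j m"] j[OF elim]
        unfolding b_def V_def by linarith
    qed
  qed
  then have "(\<lambda>m. ?D m powr (1 / p)) \<longlonglongrightarrow> 0"
    using p0 lp_suminf_nonneg[OF bp] by (intro tendsto_zero_powrI[OF _ tendsto_const]) auto
  then have "(\<lambda>m. lp_norm p (y m - boundary_point s z (j m))) \<longlonglongrightarrow> 0" by (simp only: lp_norm_def)
  then show thesis using jA that by blast
qed

text \<open>One function and one precision are treated at a time, which lets the index set, and with
  it the peak functions, depend on both.\<close>

lemma gleason_part_ball_closure_eq:
  assumes p: "1 < p" and s: "0 < s" and z: "z \<in> lp_space p" and zs: "(\<Sum>i. norm (z i) powr p) = 1 - s powr p"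
    and \<phi>: "\<phi> \<in> cluster_points (spectrum_topology p) (\<lambda>k. eval_hom p (boundary_point s z k))"
    and \<psi>: "\<psi> \<in> gleason_part p \<phi>" "\<psi> \<in> ball_closure p" and g: "g \<in> Au p"
  shows "\<psi> g = \<phi> g"
proof -
  have p1: "1 \<le> p" and p0: "0 < p" using p by auto
  have \<phi>s: "\<phi> \<in> Au_spectrum p" using \<phi> by (simp add: cluster_points_def topspace_spectrum)
  have \<psi>s: "\<psi> \<in> Au_spectrum p" and d: "spectrum_dist p \<phi> \<psi> < 2" using \<psi>(1) by (auto simp: gleason_part_def)
  \<comment> \<open>The margin 2 above p is what membership of the peak functions in the algebra
    asks for; \<open>N\<close> and \<open>Suc N\<close> are the two exponents.\<close>
  define N where "N = nat \<lceil>p\<rceil> + 2"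
  have N: "p + 2 \<le> real N" unfolding N_def using p0 by (simp add: of_nat_ceiling)
  have "dist (\<psi> g) (\<phi> g) \<le> 0 + e" if e0: "0 < e" for e
  proof -
    define e' where "e' = e / 3"
    have e: "0 < e'" using e0 by (simp add: e'_def)
    \<comment> \<open>Infinite because \<phi> is a cluster point, but possibly with infinite
      complement, so the power sum has to be restricted to it.\<close>
    define A where "A = {k. dist (eval_hom p (boundary_point s z k) g) (\<phi> g) < e'}"
    define F where "F n m = (\<lambda>y. if y \<in> lp_ball p then peak_fun p s z A n m y else 0)" for n m
    have F: "F n m \<in> Au p" if "N \<le> n" for n m
      unfolding F_def using that N by (intro peak_fun_in_Au p) simp
    have \<phi>F: "norm (\<phi> (F n m) - 1) \<le>
        (1 - exp (- (real n / (p * s powr p)) * lp_tail p m z)) + lp_tail p m z / s ^ n" (is "_ \<le> ?c")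
      if n: "N \<le> n" for n m
    proof (rule field_le_epsilon)
      fix \<omega> :: real assume \<omega>: "0 < \<omega>"
      \<comment> \<open>Testing \<open>g\<close> together with the peak function yields an index
        that lies in \<open>A\<close> and at the same time reveals the value of \<phi> at the peak
        function.\<close>
      have "\<exists>\<^sub>F k in sequentially. \<forall>f\<in>{g, F n m}. dist (eval_hom p (boundary_point s z k) f) (\<phi> f) < min e' \<omega>"
        using F[OF n] g e \<omega> by (intro cluster_pointD[OF \<phi>]) auto
      then have "\<exists>\<^sub>F k in sequentially. (\<forall>f\<in>{g, F n m}. dist (eval_hom p (boundary_point s z k) f) (\<phi> f) < min e' \<omega>) \<and> m \<le> k"
        by (rule frequently_eventually_frequently[OF _ eventually_ge_at_top])
      then obtain k where k: "dist (eval_hom p (boundary_point s z k) g) (\<phi> g) < e'"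
        "dist (eval_hom p (boundary_point s z k) (F n m)) (\<phi> (F n m)) < \<omega>" "m \<le> k"
        using frequently_ex by force
      have "norm (eval_hom p (boundary_point s z k) (F n m) - 1) \<le> ?c"
        unfolding F_def using k N n by (intro eval_peak_fun_near_1 p s z zs) (auto simp: A_def)
      then show "norm (\<phi> (F n m) - 1) \<le> ?c + \<omega>"
        using k(2) norm_triangle_ineq[of "\<phi> (F n m) - eval_hom p (boundary_point s z k) (F n m)"
            "eval_hom p (boundary_point s z k) (F n m) - 1"]
        by (simp add: dist_norm norm_minus_commute)
    qed
    have \<psi>F: "(\<lambda>m. \<psi> (F n m)) \<longlonglongrightarrow> 1" if n: "N \<le> n" for n
    proof (rule tendstoI)
      fix \<eta> :: real assume "0 < \<eta>"
      then obtain \<omega> where \<omega>: "0 < \<omega>" "\<And>f. f \<in> Au p \<Longrightarrow> (\<And>x. x \<in> lp_ball p \<Longrightarrow> norm (f x) \<le> 1) \<Longrightarrow>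
          norm (\<phi> f - 1) < \<omega> \<Longrightarrow> norm (\<psi> f - 1) < \<eta>"
        using gleason_part_peak[OF p1 \<phi>s \<psi>s d] by blast
      have "(\<lambda>m. (1 - exp (- (real n / (p * s powr p)) * lp_tail p m z)) + lp_tail p m z / s ^ n)
          \<longlonglongrightarrow> (1 - exp (- (real n / (p * s powr p)) * 0)) + 0 / s ^ n"
        using s by (intro tendsto_intros lp_tail_tendsto_0 z) auto
      then have "\<forall>\<^sub>F m in sequentially. (1 - exp (- (real n / (p * s powr p)) * lp_tail p m z)) + lp_tail p m z / s ^ n < \<omega>"
        using \<omega>(1) by (intro order_tendstoD(2)) auto
      then show "\<forall>\<^sub>F m in sequentially. dist (\<psi> (F n m)) 1 < \<eta>"
      proof eventually_elim
        case (elim m)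
        have "norm (\<psi> (F n m) - 1) < \<eta>"
        proof (rule \<omega>(2)[OF F[OF n]])
          show "norm (F n m x) \<le> 1" if "x \<in> lp_ball p" for x
            unfolding F_def using that norm_peak_fun_le_1[OF p s that, of n z A m] N n by simp
          show "norm (\<phi> (F n m) - 1) < \<omega>" using \<phi>F[OF n, of m] elim by simp
        qed
        then show ?case by (simp add: dist_norm)
      qed
    qed
    \<comment> \<open>With \<open>g\<close> among the tested functions, the very points that
      concentrate near boundary points also compute \<psi> g.\<close>
    have "\<exists>y\<in>lp_ball p. \<forall>f\<in>{g, F N m, F (Suc N) m}. dist (f y) (\<psi> f) < inverse (real (Suc m))" for m
    proof -
      have "{g, F N m, F (Suc N) m} \<subseteq> Au p" using F[of N m] F[of "Suc N" m] g by simp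
      from ball_closureD[OF \<psi>(2) p1 _ this, of "inverse (real (Suc m))"] show ?thesis by (metis finite.simps inverse_positive_iff_positive of_nat_0_less_iff zero_less_Suc)
    qed
    then obtain y where y: "\<And>m. y m \<in> lp_ball p"
      "\<And>m f. f \<in> {g, F N m, F (Suc N) m} \<Longrightarrow> dist (f (y m)) (\<psi> f) < inverse (real (Suc m))"
      by metis
    have pk: "(\<lambda>m. peak_fun p s z A n m (y m)) \<longlonglongrightarrow> 1" if n: "n = N \<or> n = Suc N" for n
    proof -
      have "(\<lambda>m. F n m (y m) - \<psi> (F n m)) \<longlonglongrightarrow> 0"
      proof (rule Lim_null_comparison[OF _ LIMSEQ_inverse_real_of_nat])
        show "\<forall>\<^sub>F m in sequentially. norm (F n m (y m) - \<psi> (F n m)) \<le> inverse (real (Suc m))"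
          using y(2) n by (intro always_eventually allI) (auto simp: dist_norm intro: less_imp_le)
      qed
      moreover have "(\<lambda>m. \<psi> (F n m)) \<longlonglongrightarrow> 1" using n by (intro \<psi>F) auto
      ultimately have "(\<lambda>m. (F n m (y m) - \<psi> (F n m)) + \<psi> (F n m)) \<longlonglongrightarrow> 0 + 1" by (rule tendsto_add)
      then have "(\<lambda>m. F n m (y m)) \<longlonglongrightarrow> 1" by simp
      then show ?thesis using y(1) by (simp add: F_def)
    qed
    obtain j where j: "\<forall>\<^sub>F m in sequentially. j m \<in> A"
      "(\<lambda>m. lp_norm p (y m - boundary_point s z (j m))) \<longlonglongrightarrow> 0"
      using peak_fun_concentration[OF p s z zs _ y(1) pk pk, of N] N by auto
    obtain \<delta> where \<delta>: "0 < \<delta>" "\<And>x y. x \<in> lp_space p \<Longrightarrow> lp_norm p x \<le> 1 \<Longrightarrow> y \<in> lp_ball p \<Longrightarrow>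
        lp_norm p (y - x) < \<delta> \<Longrightarrow> norm (g y - Au_extension p g x) \<le> e'"
      using Au_extension_near[OF p1 g e] by blast
    have "\<forall>\<^sub>F m in sequentially. lp_norm p (y m - boundary_point s z (j m)) < \<delta>"
      using order_tendstoD(2)[OF j(2) \<delta>(1)] .
    moreover have "\<forall>\<^sub>F m in sequentially. inverse (real (Suc m)) < e'"
      using order_tendstoD(2)[OF LIMSEQ_inverse_real_of_nat e] .
    ultimately have "\<forall>\<^sub>F m in sequentially. lp_norm p (y m - boundary_point s z (j m)) < \<delta> \<and>
        inverse (real (Suc m)) < e' \<and> j m \<in> A"
      using j(1) by eventually_elim simp
    then obtain m where m: "lp_norm p (y m - boundary_point s z (j m)) < \<delta>" "inverse (real (Suc m)) < e'" "j m \<in> A"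
      using eventually_happens'[OF sequentially_bot] by blast
    have "dist (g (y m)) (eval_hom p (boundary_point s z (j m)) g) \<le> e'"
      using \<delta>(2)[OF boundary_point_closed_ball[OF p0 s z zs] y(1) m(1)] g by (simp add: eval_hom_def dist_norm)
    moreover have "dist (eval_hom p (boundary_point s z (j m)) g) (\<phi> g) < e'" using m(3) by (simp add: A_def)
    moreover have "dist (g (y m)) (\<psi> g) < e'" using y(2)[of g m] m(2) by simp
    ultimately have "dist (\<psi> g) (\<phi> g) \<le> 3 * e'"
      using dist_triangle[of "\<psi> g" "\<phi> g" "g (y m)"]
        dist_triangle[of "g (y m)" "\<phi> g" "eval_hom p (boundary_point s z (j m)) g"]
      by (simp add: dist_commute)
    then show ?thesis by (simp add: e'_def)
  qed
  then have "dist (\<psi> g) (\<phi> g) \<le> 0" by (rule field_le_epsilon)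
  then show ?thesis by simp
qed

theorem proposition3p12:
  fixes p s :: real
    and z :: "nat \<Rightarrow> complex"
    and \<phi> :: "((nat \<Rightarrow> complex) \<Rightarrow> complex) \<Rightarrow> complex"
  assumes "1 < p"
    and "z \<in> lp_ball p"
    and "s = (1 - lp_norm p z powr p) powr (1 / p)"
    and "\<phi> \<in> cluster_points (spectrum_topology p)
           (\<lambda>n. eval_hom p (lp_proj n z + (\<lambda>i. of_real s * lp_unit n i)))"
  shows "gleason_part p \<phi> \<inter> ball_closure p = {\<phi>} \<and>
         (corona p = {} \<longrightarrow> gleason_part p \<phi> = {\<phi>})"
proof -
  have p: "0 < p" "1 \<le> p" using assms(1) by auto
  have z: "z \<in> lp_space p" using assms(2) by (rule lp_ball_subset)
  have n: "lp_norm p z powr p < 1"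
    using lp_norm_powr[OF p(1) z] lp_suminf_powr_less_1[OF p(1) assms(2)] by simp
  \<comment> \<open>A mass balance: \<open>s powr p\<close> is what the mass of z lacks to 1, and it
    is positive because z lies in the open ball.\<close>
  then have s: "0 < s" and sp: "s powr p = 1 - lp_norm p z powr p"
    using p by (auto simp: assms(3) powr_powr)
  then have zs: "(\<Sum>i. norm (z i) powr p) = 1 - s powr p" using lp_norm_powr[OF p(1) z] by simp
  have \<phi>: "\<phi> \<in> cluster_points (spectrum_topology p) (\<lambda>k. eval_hom p (boundary_point s z k))"
    using assms(4) by (simp only: boundary_point_def)
  have \<phi>s: "\<phi> \<in> Au_spectrum p" using \<phi> by (simp add: cluster_points_def topspace_spectrum)
  have "\<phi> \<in> gleason_part p \<phi>" using \<phi>s by (simp add: gleason_part_def spectrum_dist_self)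
  moreover have "\<phi> \<in> ball_closure p"
    by (rule cluster_point_in_ball_closure[OF p(2) boundary_point_closed_ball[OF p(1) s z zs] \<phi>])
  moreover have "\<psi> = \<phi>" if "\<psi> \<in> gleason_part p \<phi>" "\<psi> \<in> ball_closure p" for \<psi>
  proof (rule extensionalityI)
    show "\<psi> \<in> extensional (Au p)" "\<phi> \<in> extensional (Au p)"
      using that(1) \<phi>s by (auto simp: gleason_part_def Au_spectrum_def)
    show "\<psi> g = \<phi> g" if "g \<in> Au p" for g
      by (rule gleason_part_ball_closure_eq[OF assms(1) s z zs \<phi>
            \<open>\<psi> \<in> gleason_part p \<phi>\<close> \<open>\<psi> \<in> ball_closure p\<close> that])
  qed
  ultimately have eq: "gleason_part p \<phi> \<inter> ball_closure p = {\<phi>}" by blast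
  \<comment> \<open>With an empty corona the closure is the whole spectrum and hence contains every
    Gleason part.\<close>
  moreover have "gleason_part p \<phi> \<subseteq> ball_closure p" if "corona p = {}"
    using that by (auto simp: corona_def gleason_part_def)
  ultimately show ?thesis by blast
qed

end
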